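(* Let $\mathbf{P}$ be a poset of finite cardinality $n$ and width $w$, and let $\mathbf{T}(n,w)$ denote a Turán poset of cardinality $n$ and width $w$. Then $|\mathcal{AC}^s(\mathbf{P})|\leq|\mathcal{AC}^s(\mathbf{T}(n,w))|$.
   Context: Partial orders $\leq$ are reflexive. The width of a poset is the number of elements of its largest antichain. For a poset $\mathbf{P}=(X,\leq)$, $\mathrm{inc}(\mathbf{P})$ is the set of ordered pairs $(x,y)$ of elements of $X$ that are incomparable. An alternating cycle of $\mathbf{P}$ is a cyclically ordered tuple $S=[(x_1,y_1),\ldots,(x_k,y_k)]$ with each $(x_i,y_i)\in\mathrm{inc}(\mathbf{P})$ and $y_i\leq x_{i+1}$ for every $i$, indices modulo $k$; two such tuples of the same length $k$ are considered identical iff they differ by a cyclic shift of the index. It is strict if $y_i\leq x_j$ implies $j=i+1$ modulo $k$. $\mathcal{AC}^s(\mathbf{P})$ denotes the set of strict alternating cycles of $\mathbf{P}$. For positive integers $w\leq n$, a Turán poset $\mathbf{T}(n,w)$ on $n$ elements with width $w$ is a disjoint union of $w$ nonempty chains (elements of different chains being incomparable) whose numbers of elements are as close as possible to $n/w$: if $n\equiv r \pmod w$ with $0\leq r<w$, then $r$ of the chains have $\lfloor n/w\rfloor+1$ elements and the remaining $w-r$ have $\lfloor n/w\rfloor$ elements. *)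

theory Defs
  imports "HOL-Library.Disjoint_Sets"
begin

text \<open>A poset is a carrier \<open>X\<close> together with a relation \<open>r\<close> such that
  \<open>partial_order_on X r\<close>; \<open>(x, y) \<in> r\<close> is read as \<open>x \<le> y\<close>.\<close>

definition incomparable_pairs :: "'a set \<Rightarrow> 'a rel \<Rightarrow> ('a \<times> 'a) set" where
  "incomparable_pairs X r = {(x, y). x \<in> X \<and> y \<in> X \<and> (x, y) \<notin> r \<and> (y, x) \<notin> r}"

definition antichain :: "'a set \<Rightarrow> 'a rel \<Rightarrow> 'a set \<Rightarrow> bool" where
  "antichain X r A \<longleftrightarrow>
     A \<subseteq> X \<and> (\<forall>x\<in>A. \<forall>y\<in>A. x \<noteq> y \<longrightarrow> (x, y) \<in> incomparable_pairs X r)"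

text \<open>Meaningful for finite \<open>X\<close> only.\<close>

definition poset_width :: "'a set \<Rightarrow> 'a rel \<Rightarrow> nat" where
  "poset_width X r = Max (card ` {A. antichain X r A})"

text \<open>A list \<open>S\<close> of length \<open>k\<close> represents the tuple of the pairs
  \<open>(x\<^sub>i, y\<^sub>i) = S ! i\<close>, where \<open>i\<close> ranges over \<open>0, \<dots>, k - 1\<close>.
  The empty tuple is excluded, and \<open>k = 1\<close> is impossible because the entries
  are incomparable pairs.\<close>

definition alternating_cycle :: "'a set \<Rightarrow> 'a rel \<Rightarrow> ('a \<times> 'a) list \<Rightarrow> bool" where
  "alternating_cycle X r S \<longleftrightarrow>
     S \<noteq> [] \<and> set S \<subseteq> incomparable_pairs X r \<and>
     (\<forall>i<length S. (snd (S ! i), fst (S ! (Suc i mod length S))) \<in> r)"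

definition strict_alternating_cycle :: "'a set \<Rightarrow> 'a rel \<Rightarrow> ('a \<times> 'a) list \<Rightarrow> bool" where
  "strict_alternating_cycle X r S \<longleftrightarrow>
     alternating_cycle X r S \<and>
     (\<forall>i<length S. \<forall>j<length S.
        (snd (S ! i), fst (S ! j)) \<in> r \<longrightarrow> j = Suc i mod length S)"

definition cyclic_shift_rel :: "'b list rel" where
  "cyclic_shift_rel = {(S, T). \<exists>m. T = rotate m S}"

text \<open>Cyclically ordered tuples are equivalence classes of lists under cyclic shifts.\<close>

definition strict_alternating_cycles :: "'a set \<Rightarrow> 'a rel \<Rightarrow> ('a \<times> 'a) list set set" where
  "strict_alternating_cycles X r = {S. strict_alternating_cycle X r S} // cyclic_shift_rel"

text \<open>\<open>\<C>\<close> is the set of the \<open>w\<close> chains, so \<open>n mod w\<close> of them have one element more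
  than the others.\<close>

definition turan_poset :: "nat \<Rightarrow> nat \<Rightarrow> 'a set \<Rightarrow> 'a rel \<Rightarrow> bool" where
  "turan_poset n w Y s \<longleftrightarrow>
     0 < w \<and> w \<le> n \<and> finite Y \<and> card Y = n \<and> partial_order_on Y s \<and>
     (\<exists>\<C>. partition_on Y \<C> \<and> card \<C> = w \<and>
        (\<forall>C\<in>\<C>. C \<in> Chains s) \<and>
        (\<forall>C\<in>\<C>. \<forall>D\<in>\<C>. C \<noteq> D \<longrightarrow> C \<times> D \<subseteq> incomparable_pairs Y s) \<and>
        (\<forall>C\<in>\<C>. card C = n div w \<or> card C = n div w + 1) \<and>
        card {C \<in> \<C>. card C = n div w + 1} = n mod w)"

text \<open>Turan posets exist for all parameters, as the residue classes modulo \<open>w\<close> show.\<close>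

lemma turan_poset_residue_classes:
  fixes n w :: nat
  assumes w: "0 < w" "w \<le> n"
  shows "turan_poset n w {..<n} {(i, j). i \<le> j \<and> j < n \<and> i mod w = j mod w}"
proof -
  define s where "s = {(i, j). i \<le> j \<and> j < n \<and> i mod w = j mod w}"
  define C where "C = (\<lambda>i. {j. j < n \<and> j mod w = i})"
  have C_eq: "C i = (\<lambda>q. q * w + i) ` {..<n div w + (if i < n mod w then 1 else 0)}"
    if i: "i < w" for i
  proof -
    have *: "q * w + i < n \<longleftrightarrow> q < n div w + (if i < n mod w then 1 else 0)" for q
    proof -
      have n: "n = n div w * w + n mod w" by simp
      consider "q < n div w" | "q = n div w" | "q > n div w" by linarith
      then show ?thesis
      proof cases
        case 1
        then have "Suc q * w \<le> n div w * w" by (intro mult_right_mono) auto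
        then have "q * w + w \<le> n div w * w" by simp
          then have "q * w + w \<le> n" using div_times_less_eq_dividend le_trans by blast
        then show ?thesis using 1 i by auto
      next
        case 2
        have "n div w * w + i < n \<longleftrightarrow> n div w * w + i < n div w * w + n mod w"
            by simp
          then have "n div w * w + i < n \<longleftrightarrow> i < n mod w" by (simp only: nat_add_left_cancel_less)
          then show ?thesis using 2 by simp
      next
        case 3
        then have "Suc (n div w) * w \<le> q * w" by (intro mult_right_mono) auto
        then have "n div w * w + w \<le> q * w" by simp
        moreover have "n mod w < w" using w by simp
        ultimately have "n < q * w" using n by linarith
        then show ?thesis using 3 by auto
      qed
    qed
    show ?thesis
    proof (intro set_eqI iffI)
      fix j assume "j \<in> C i"
      then have j: "j < n" "j mod w = i" by (auto simp: C_def)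
      have "j = j div w * w + i" using j(2) div_mult_mod_eq[of j w] by simp
      then show "j \<in> (\<lambda>q. q * w + i) ` {..<n div w + (if i < n mod w then 1 else 0)}"
        using *[of "j div w"] j(1) by (intro image_eqI[of _ _ "j div w"]) auto
    next
      fix j assume "j \<in> (\<lambda>q. q * w + i) ` {..<n div w + (if i < n mod w then 1 else 0)}"
      then obtain q where "j = q * w + i" "j < n" using * by auto
      then show "j \<in> C i" using i by (auto simp: C_def)
    qed
  qed
  have card_C: "card (C i) = n div w + (if i < n mod w then 1 else 0)" if "i < w" for i
    unfolding C_eq[OF that] using w by (subst card_image) (auto simp: inj_on_def)
  have i_in: "i \<in> C i" if "i < w" for i
    using that w by (auto simp: C_def)
  have inj: "inj_on C {..<w}"
  proof (rule inj_onI)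
    fix i j assume ij: "i \<in> {..<w}" "j \<in> {..<w}" "C i = C j"
    then have "i \<in> C j" using i_in[of i] by simp
    then show "i = j" using ij(1) by (simp add: C_def)
  qed
  have "{D \<in> C ` {..<w}. card D = n div w + 1} = C ` {..<n mod w}"
  proof -
    have "card (C i) = n div w + 1 \<longleftrightarrow> i < n mod w" if "i < w" for i
      using card_C[OF that] by (simp split: if_splits)
    moreover have "i < w" if "i < n mod w" for i
      using that mod_less_divisor[OF w(1), of n] by (rule less_trans)
    ultimately show ?thesis by blast
  qed
  moreover have "card (C ` {..<n mod w}) = n mod w"
  proof -
    have "{..<n mod w} \<subseteq> {..<w}" using mod_less_divisor[OF w(1), of n] by simp
    then have "inj_on C {..<n mod w}" by (rule inj_on_subset[OF inj])
    then show ?thesis by (simp add: card_image)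
  qed
  moreover have "card (C ` {..<w}) = w" using inj by (simp add: card_image)
  moreover have "partition_on {..<n} (C ` {..<w})"
  proof (rule partition_onI)
    show "\<Union> (C ` {..<w}) = {..<n}"
      using mod_less_divisor[OF w(1)] unfolding C_def by blast
  next
    show "{} \<notin> C ` {..<w}" using i_in by blast
  qed (auto simp: disjnt_def C_def)
  moreover have "partial_order_on {..<n} s"
    unfolding partial_order_on_def preorder_on_def
  proof (intro conjI)
    show "s \<subseteq> {..<n} \<times> {..<n}" by (auto simp: s_def)
    show "refl_on {..<n} s" by (simp add: refl_on_def s_def)
    show "trans s"
    proof (rule transI)
      fix i j k assume "(i, j) \<in> s" "(j, k) \<in> s"
      then show "(i, k) \<in> s" unfolding s_def mem_Collect_eq case_prod_conv
        by (metis order_trans)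
    qed
    show "antisym s" unfolding s_def by (rule antisymI) simp
  qed
  moreover have "\<forall>D\<in>C ` {..<w}. D \<in> Chains s"
    by (simp add: C_def Chains_def s_def linear)
  moreover have "\<forall>D\<in>C ` {..<w}. \<forall>E\<in>C ` {..<w}.
      D \<noteq> E \<longrightarrow> D \<times> E \<subseteq> incomparable_pairs {..<n} s"
    by (auto simp: C_def incomparable_pairs_def s_def)
  moreover have "\<forall>D\<in>C ` {..<w}. card D = n div w \<or> card D = n div w + 1"
    using card_C by auto
  ultimately show ?thesis
    unfolding turan_poset_def s_def[symmetric] using w
    by (intro conjI exI[of _ "C ` {..<w}"]) simp_all
qed

lemma equiv_cyclic_shift_rel: "equiv UNIV (cyclic_shift_rel :: 'b list rel)"
proof (rule equivI)
  show "refl (cyclic_shift_rel :: 'b list rel)"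
    unfolding refl_on_def cyclic_shift_rel_def by (auto intro: exI[of _ 0])
  show "sym (cyclic_shift_rel :: 'b list rel)"
  proof (rule symI)
    fix S T :: "'b list" assume "(S, T) \<in> cyclic_shift_rel"
    then obtain m where T: "T = rotate m S" by (auto simp: cyclic_shift_rel_def)
    show "(T, S) \<in> cyclic_shift_rel"
    proof (cases "S = []")
      case True
      then show ?thesis using T by (auto simp: cyclic_shift_rel_def)
    next
      case False
      define k where "k = length S - m mod length S"
      have lt: "m mod length S < length S" using False by simp
      have "rotate k T = rotate (k + m) S" by (simp add: T rotate_rotate)
      also have "\<dots> = rotate ((k + m) mod length S) S" by (rule rotate_conv_mod)
      also have "(k + m) mod length S = (k + m mod length S) mod length S"
        by (simp add: mod_add_right_eq)
      also have "k + m mod length S = length S" using lt by (simp add: k_def)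
      finally have "S = rotate k T" by simp
      then show ?thesis unfolding cyclic_shift_rel_def by blast
    qed
  qed
  show "trans (cyclic_shift_rel :: 'b list rel)"
    unfolding trans_def cyclic_shift_rel_def by (auto simp: rotate_rotate)
qed auto

lemma strict_alternating_cycle_distinct:
  assumes "strict_alternating_cycle X r S"
  shows "distinct S"
  unfolding distinct_conv_nth
proof (intro allI impI)
  fix i j assume ij: "i < length S" "j < length S" "i \<noteq> j"
  show "S ! i \<noteq> S ! j"
  proof
    assume eq: "S ! i = S ! j"
    define k where "k = (if i = 0 then length S - 1 else i - 1)"
    have k: "k < length S" "Suc k mod length S = i"
      using ij by (auto simp: k_def)
    have "(snd (S ! k), fst (S ! i)) \<in> r"
      using assms k unfolding strict_alternating_cycle_def alternating_cycle_def by metis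
    then have "j = Suc k mod length S"
      using assms k(1) ij(2) eq unfolding strict_alternating_cycle_def by metis
    then show False using k ij by simp
  qed
qed

text \<open>The cardinalities of these sets are therefore genuine for finite posets.\<close>

lemma finite_strict_alternating_cycles:
  assumes "finite X"
  shows "finite (strict_alternating_cycles X r)"
proof -
  have "{S. strict_alternating_cycle X r S} \<subseteq> {S. set S \<subseteq> X \<times> X \<and> distinct S}"
    using strict_alternating_cycle_distinct[of X r]
    by (auto simp: strict_alternating_cycle_def alternating_cycle_def incomparable_pairs_def)
  moreover have "finite {S. set S \<subseteq> X \<times> X \<and> distinct S}"
    using assms by (intro finite_subset_distinct) auto
  ultimately have "finite {S. strict_alternating_cycle X r S}"
    by (rule finite_subset)
  then show ?thesis
    unfolding strict_alternating_cycles_def quotient_def by simp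
qed

end

theory Submission
  imports Defs "HOL-Combinatorics.Multiset_Permutations" "HOL-Library.FuncSet"
begin

text \<open>
  By Dilworth's theorem (\<open>dilworth\<close>), a finite poset of width \<open>w\<close> is partitioned into \<open>w\<close> chains.
  The proof compares the poset with the disjoint union of these chains, computes the number of
  strict alternating cycles of any disjoint union of chains, and balances the chain sizes.

  \<^item> In a strict alternating cycle, \<open>y\<^sub>i \<le> x\<^sub>j\<close> holds for \<open>j = i + 1\<close> only. The set of its
    pairs therefore determines the cyclic order, and cycles can be counted as sets of pairs
    (\<open>card_strict_alternating_cycles_eq\<close>).

  \<^item> Let a finite poset be partitioned into chains and delete all comparabilities between
    different chains. Given a strict alternating cycle of the poset, insert the pair
    \<open>(y\<^sub>i, x\<^sub>i\<^sub>+\<^sub>1)\<close> after \<open>(x\<^sub>i, y\<^sub>i)\<close> whenever \<open>y\<^sub>i \<le> x\<^sub>i\<^sub>+\<^sub>1\<close> is one of the deleted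
    comparabilities. By strictness, different \<open>x\<^sub>i\<close> lie in different chains, different \<open>y\<^sub>i\<close> lie in
    different chains, and \<open>y\<^sub>i\<close> shares a chain with \<open>x\<^sub>j\<close> only if \<open>j = i + 1\<close>. The new cycle
    therefore visits no chain twice, which makes it a strict alternating cycle of the union of the
    chains. The inserted pairs are comparable in the poset and the old ones are not, so the old
    cycle can be read off from the new one (\<open>strict_alternating_cycle_refine\<close>).
    Hence the deletion does not decrease the number of strict alternating cycles.

  \<^item> In a disjoint union of chains, a strict alternating cycle amounts to a cyclic order of a
    set of at least two chains and an interval \<open>y\<^sub>i \<le> x\<^sub>i\<^sub>+\<^sub>1\<close> in each of them. With chain sizes
    \<open>c\<^sub>1, \<dots>, c\<^sub>w\<close> their number is the sum of \<open>(|K| - 1)! \<cdot> (\<Prod>i\<in>K. c\<^sub>i (c\<^sub>i + 1) / 2)\<close> over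
    all sets \<open>K\<close> of at least two chains (\<open>card_strict_alternating_cycles_chain_union\<close>).

  \<^item> Moving an element from a chain to one that is smaller by at least two lowers the sum of
    their two interval numbers by some \<open>d\<close> and raises the product by at least \<open>d\<close>. Products weigh
    at least as much as single factors, since they belong to larger sets \<open>K\<close>, so the number of
    cycles does not decrease (\<open>subset_product_sum_balance\<close>). The process ends with the sizes of
    a Turan poset.
\<close>

section \<open>Strict alternating cycles as sets of pairs\<close>

text \<open>After a pair \<open>(x, y)\<close> comes the only pair of the cycle whose first component is above \<open>y\<close>.
  Two cycles with the same pairs that agree at one place therefore agree from there on.\<close>

lemma rotate_of_same_set_strict_alternating_cycles:
  assumes S: "strict_alternating_cycle X r S" and T: "strict_alternating_cycle X r T"
    and eq: "set S = set T"
  shows "\<exists>m. T = rotate m S"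
proof -
  define k where "k = length S"
  have len: "length T = k"
    using strict_alternating_cycle_distinct[OF S] strict_alternating_cycle_distinct[OF T] eq
    unfolding k_def by (metis distinct_card)
  have "S \<noteq> []"
    using S by (simp add: strict_alternating_cycle_def alternating_cycle_def)
  then have k: "k > 0" by (simp add: k_def)
  then have "T ! 0 \<in> set S" using eq len by simp
  then obtain m where m: "m < k" "S ! m = T ! 0"
    unfolding in_set_conv_nth k_def by blast
  have "T ! i = S ! ((m + i) mod k)" if "i < k" for i
    using that
  proof (induction i)
    case 0
    then show ?case using m by simp
  next
    case (Suc i)
    then have IH: "T ! i = S ! ((m + i) mod k)" by simp
    have "T ! Suc i \<in> set S" using Suc.prems eq len by simp
    then obtain j where j: "j < k" "S ! j = T ! Suc i"
      unfolding in_set_conv_nth k_def by blast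
    have "(snd (T ! i), fst (T ! (Suc i mod length T))) \<in> r"
      using T Suc_lessD[OF Suc.prems] len
      unfolding strict_alternating_cycle_def alternating_cycle_def by blast
    then have "(snd (S ! ((m + i) mod k)), fst (S ! j)) \<in> r"
      using j IH Suc.prems len by simp
    moreover have "(m + i) mod k < length S" "j < length S" using k j by (simp_all add: k_def)
    ultimately have "j = Suc ((m + i) mod k) mod k"
      using S unfolding strict_alternating_cycle_def k_def by blast
    then have "j = (m + Suc i) mod k" by (simp add: mod_Suc_eq)
    then show ?case using j by simp
  qed
  then have "T = rotate m S"
    by (intro nth_equalityI) (auto simp: len k_def nth_rotate)
  then show ?thesis by blast
qed

text \<open>Two functions with the same kernel have equally many values; this trades the cyclic class
  of a list for its set of entries.\<close>

lemma card_image_eq_card_image: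
  assumes "\<And>x y. x \<in> A \<Longrightarrow> y \<in> A \<Longrightarrow> F x = F y \<longleftrightarrow> G x = G y"
  shows "card (F ` A) = card (G ` A)"
proof -
  define h where "h = (\<lambda>c. F (inv_into A G c))"
  have h: "h (G x) = F x" if "x \<in> A" for x
  proof -
    have "inv_into A G (G x) \<in> A" "G (inv_into A G (G x)) = G x"
      using that by (auto intro: inv_into_into f_inv_into_f)
    then show ?thesis using assms that unfolding h_def by blast
  qed
  have "inj_on h (G ` A)" using h assms by (auto simp: inj_on_def)
  moreover have "h ` (G ` A) = F ` A" using h by (auto simp: image_iff)
  ultimately show ?thesis using card_image by metis
qed

lemma card_strict_alternating_cycles_eq:
  "card (strict_alternating_cycles X r) = card (set ` {S. strict_alternating_cycle X r S})"
proof -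
  have quot: "strict_alternating_cycles X r
      = (\<lambda>S. cyclic_shift_rel `` {S}) ` {S. strict_alternating_cycle X r S}"
    unfolding strict_alternating_cycles_def quotient_def by blast
  show ?thesis
    unfolding quot
  proof (rule card_image_eq_card_image)
    fix S T :: "('a \<times> 'a) list"
    assume "S \<in> {S. strict_alternating_cycle X r S}" "T \<in> {S. strict_alternating_cycle X r S}"
    then have "(S, T) \<in> cyclic_shift_rel \<longleftrightarrow> set S = set T"
      using rotate_of_same_set_strict_alternating_cycles[of X r S T]
      by (auto simp: cyclic_shift_rel_def)
    then show "cyclic_shift_rel `` {S} = cyclic_shift_rel `` {T} \<longleftrightarrow> set S = set T"
      using eq_equiv_class_iff[OF equiv_cyclic_shift_rel] by blast
  qed
qed

lemma finite_sets_of_strict_alternating_cycles: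
  assumes "finite X"
  shows "finite (set ` {S. strict_alternating_cycle X r S})"
proof (rule finite_subset)
  show "set ` {S. strict_alternating_cycle X r S} \<subseteq> Pow (X \<times> X)"
    by (auto simp: strict_alternating_cycle_def alternating_cycle_def incomparable_pairs_def)
qed (use assms in simp)

section \<open>Successors inside a strict alternating cycle\<close>

definition succ_pair :: "'a rel \<Rightarrow> ('a \<times> 'a) list \<Rightarrow> 'a \<times> 'a \<Rightarrow> 'a \<times> 'a" where
  "succ_pair r S p = (THE q. q \<in> set S \<and> (snd p, fst q) \<in> r)"

text \<open>The cyclic order as a permutation of the set of pairs, which spares later arguments the
  indices modulo the length.\<close>

lemma strict_alternating_cycle_succ_pair:
  assumes S: "strict_alternating_cycle X r S"
  shows "p \<in> set S \<Longrightarrow> succ_pair r S p \<in> set S"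
    and "p \<in> set S \<Longrightarrow> q \<in> set S \<Longrightarrow> (snd p, fst q) \<in> r \<longleftrightarrow> q = succ_pair r S p"
    and "bij_betw (succ_pair r S) (set S) (set S)"
    and "i < length S \<Longrightarrow> succ_pair r S (S ! i) = S ! (Suc i mod length S)"
proof -
  define k where "k = length S"
  let ?succ = "succ_pair r S"
  have dist: "distinct S" by (rule strict_alternating_cycle_distinct[OF S])
  have "S \<noteq> []"
    using S by (simp add: strict_alternating_cycle_def alternating_cycle_def)
  then have k: "Suc i mod k < k" for i by (simp add: k_def)
  have R: "(snd (S ! i), fst (S ! j)) \<in> r \<longleftrightarrow> j = Suc i mod k" if "i < k" "j < k" for i j
    using S that unfolding strict_alternating_cycle_def alternating_cycle_def k_def by blast
  have succ: "?succ (S ! i) = S ! (Suc i mod k)" if i: "i < k" for i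
    unfolding succ_pair_def
  proof (rule the_equality)
    show "S ! (Suc i mod k) \<in> set S \<and> (snd (S ! i), fst (S ! (Suc i mod k))) \<in> r"
      using R[OF i k] k[of i] by (simp add: k_def)
  next
    fix q assume "q \<in> set S \<and> (snd (S ! i), fst q) \<in> r"
    then show "q = S ! (Suc i mod k)" using R[OF i] by (auto simp: in_set_conv_nth k_def)
  qed
  then show "i < length S \<Longrightarrow> ?succ (S ! i) = S ! (Suc i mod length S)"
    by (simp add: k_def)
  have closed: "?succ p \<in> set S" if "p \<in> set S" for p
  proof -
    obtain i where "i < k" "p = S ! i" using \<open>p \<in> set S\<close> by (auto simp: in_set_conv_nth k_def)
    then show ?thesis using succ[of i] k[of i] by (simp add: k_def)
  qed
  then show "p \<in> set S \<Longrightarrow> ?succ p \<in> set S" .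
  show "(snd p, fst q) \<in> r \<longleftrightarrow> q = ?succ p" if "p \<in> set S" "q \<in> set S"
  proof -
    obtain i j where ij: "i < k" "p = S ! i" "j < k" "q = S ! j"
      using \<open>p \<in> set S\<close> \<open>q \<in> set S\<close> unfolding in_set_conv_nth k_def by metis
    have "q = ?succ p \<longleftrightarrow> j = Suc i mod k"
      using ij succ[of i] dist k[of i] by (simp add: nth_eq_iff_index_eq k_def)
    then show ?thesis using ij R by simp
  qed
  have "set S \<subseteq> ?succ ` set S"
  proof
    fix q assume "q \<in> set S"
    then obtain j where j: "j < k" "q = S ! j" unfolding in_set_conv_nth k_def by metis
    define i where "i = (if j = 0 then k - 1 else j - 1)"
    have "i < k" "Suc i mod k = j" using j by (auto simp: i_def)
    then have "q = ?succ (S ! i)" "S ! i \<in> set S" using succ[of i] j by (simp_all add: k_def)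
    then show "q \<in> ?succ ` set S" by blast
  qed
  then have "?succ ` set S = set S" using closed by blast
  then show "bij_betw ?succ (set S) (set S)"
    unfolding bij_betw_def by (auto intro: eq_card_imp_inj_on)
qed

text \<open>If \<open>q\<close> precedes \<open>p\<close>, then the second component of \<open>q\<close> is below both first components, and
  strictness leaves only one successor of \<open>q\<close>.\<close>

lemma strict_alternating_cycle_fst_eqI:
  assumes S: "strict_alternating_cycle X r S" and r: "trans r"
    and p: "p \<in> set S" "p' \<in> set S" "(fst p, fst p') \<in> r"
  shows "p = p'"
proof -
  define succ where "succ = succ_pair r S"
  note succ = strict_alternating_cycle_succ_pair[OF S, folded succ_def]
  obtain q where q: "q \<in> set S" "p = succ q"
    using succ(3) p(1) unfolding bij_betw_def by blast
  then have "(snd q, fst p) \<in> r" using succ(2) p by blast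
  then have "(snd q, fst p') \<in> r" using p(3) r by (metis transD)
  then show ?thesis using succ(2) p(2) q by blast
qed

lemma strict_alternating_cycle_snd_eqI:
  assumes S: "strict_alternating_cycle X r S" and r: "trans r"
    and p: "p \<in> set S" "p' \<in> set S" "(snd p, snd p') \<in> r"
  shows "p = p'"
proof -
  define succ where "succ = succ_pair r S"
  note succ = strict_alternating_cycle_succ_pair[OF S, folded succ_def]
  have "(snd p', fst (succ p')) \<in> r" using succ p by blast
  then have "(snd p, fst (succ p')) \<in> r" using p(3) r by (metis transD)
  then have "succ p' = succ p" using succ p by blast
  then show ?thesis using succ(3) p by (metis bij_betw_def inj_onD)
qed

text \<open>For \<open>f\<close> constant on comparable elements, a cycle that meets each value once in its
  first components is strict, because only one first component can be comparable to a given
  second component.\<close>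

lemma strict_alternating_cycleI:
  assumes S: "alternating_cycle X r S"
    and f: "\<And>x y. (x, y) \<in> r \<Longrightarrow> f x = f y" and dist: "distinct (map (f \<circ> fst) S)"
  shows "strict_alternating_cycle X r S"
  unfolding strict_alternating_cycle_def
proof (intro conjI S allI impI)
  fix i j assume ij: "i < length S" "j < length S" "(snd (S ! i), fst (S ! j)) \<in> r"
  let ?j = "Suc i mod length S"
  have j: "?j < length S" using ij by (metis mod_less_divisor gr_implies_not0 gr0I)
  have "(snd (S ! i), fst (S ! ?j)) \<in> r"
    using S ij(1) by (simp add: alternating_cycle_def)
  then have "f (fst (S ! j)) = f (fst (S ! ?j))" using f ij(3) by metis
  then have "map (f \<circ> fst) S ! j = map (f \<circ> fst) S ! ?j" using ij j by simp
  then show "j = ?j" using nth_eq_iff_index_eq[OF dist] ij(2) j by simp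
qed

section \<open>Cutting a poset along a chain partition\<close>

lemma successively_concat:
  assumes "successively (\<lambda>x y. P (last (b x)) (hd (b y))) xs"
    and "\<And>x. x \<in> set xs \<Longrightarrow> b x \<noteq> [] \<and> successively P (b x)"
  shows "successively P (concat (map b xs))"
  using assms
proof (induction xs)
  case (Cons x xs)
  then show ?case
    by (cases xs) (auto simp: successively_append_iff)
qed simp

lemma distinct_concat_map:
  assumes "distinct xs" and "\<And>x. x \<in> set xs \<Longrightarrow> distinct (b x)"
    and "\<And>x y. x \<in> set xs \<Longrightarrow> y \<in> set xs \<Longrightarrow> x \<noteq> y \<Longrightarrow> set (b x) \<inter> set (b y) = {}"
  shows "distinct (concat (map b xs))"
  using assms by (induction xs) fastforce+

text \<open>Blocks of varying length can be concatenated easily for \<^const>\<open>successively\<close>, but not for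
  the condition with indices modulo the length.\<close>

lemma all_cyclic_successive_iff:
  assumes "S \<noteq> []"
  shows "(\<forall>i<length S. R (S ! i) (S ! (Suc i mod length S)))
    \<longleftrightarrow> successively R S \<and> R (last S) (hd S)"
proof -
  obtain k where k: "length S = Suc k" using assms by (cases S) auto
  have "Suc i mod Suc k = Suc i" if "i < k" for i using that by simp
  then have "(\<forall>i<length S. R (S ! i) (S ! (Suc i mod length S)))
      \<longleftrightarrow> (\<forall>i<k. R (S ! i) (S ! Suc i)) \<and> R (S ! k) (S ! 0)"
    unfolding k by (metis less_Suc_eq mod_self)
  moreover have "successively R S \<longleftrightarrow> (\<forall>i<k. R (S ! i) (S ! Suc i))"
    using k
  proof (induction S arbitrary: k)
    case (Cons x S)
    then show ?case
    proof (cases S)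
      case (Cons y T)
      with \<open>length (x # S) = Suc k\<close> obtain l where l: "k = Suc l" by (cases k) auto
      then have "successively R S \<longleftrightarrow> (\<forall>i<l. R (S ! i) (S ! Suc i))"
        using Cons.IH Cons.prems by simp
      then show ?thesis using Cons l by (auto simp: All_less_Suc2)
    qed auto
  qed simp
  ultimately show ?thesis
    using assms k by (simp add: last_conv_nth hd_conv_nth)
qed

text \<open>The pair that follows \<open>(x, y)\<close> starts with some \<open>x' \<ge> y\<close>. If \<open>y\<close> and \<open>x'\<close> lie in different chains,
  the comparability \<open>y \<le> x'\<close> is lost in the union of the chains, but there the two elements form
  an incomparable pair, and inserting \<open>(y, x')\<close> after \<open>(x, y)\<close> repairs the cycle: \<open>y \<le> y\<close> and
  \<open>x' \<le> x'\<close> replace \<open>y \<le> x'\<close>.\<close>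

lemma strict_alternating_cycle_refine:
  assumes po: "partial_order_on X r"
    and comp: "\<And>x y. x \<in> X \<Longrightarrow> y \<in> X \<Longrightarrow> f x = f y \<Longrightarrow> (x, y) \<in> r \<or> (y, x) \<in> r"
    and S: "strict_alternating_cycle X r S"
  shows "\<exists>S'. strict_alternating_cycle X {(x, y) \<in> r. f x = f y} S'
    \<and> set S' \<inter> incomparable_pairs X r = set S"
proof -
  define q where "q = {(x, y) \<in> r. f x = f y}"
  have r: "trans r" "refl_on X r" "r \<subseteq> X \<times> X"
    using po by (auto simp: partial_order_on_def preorder_on_def)
  have S_ne: "S \<noteq> []" and S_inc: "set S \<subseteq> incomparable_pairs X r"
    using S by (auto simp: strict_alternating_cycle_def alternating_cycle_def)
  have inX: "fst p \<in> X" "snd p \<in> X" if "p \<in> set S" for p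
    using S_inc that by (auto simp: incomparable_pairs_def)
  define succ where "succ = succ_pair r S"
  note succ = strict_alternating_cycle_succ_pair[OF S, folded succ_def]
  have succ_r: "(snd p, fst (succ p)) \<in> r" if "p \<in> set S" for p
    using succ that by blast
  have fst_inj: "p = p'" if "p \<in> set S" "p' \<in> set S" "f (fst p) = f (fst p')" for p p'
    using comp[OF inX(1) inX(1)] strict_alternating_cycle_fst_eqI[OF S r(1)] that by metis
  have snd_inj: "p = p'" if "p \<in> set S" "p' \<in> set S" "f (snd p) = f (snd p')" for p p'
    using comp[OF inX(2) inX(2)] strict_alternating_cycle_snd_eqI[OF S r(1)] that by metis
  \<comment> \<open>Either \<open>snd p \<le> fst p'\<close>, and \<open>p'\<close> follows \<open>p\<close>, or \<open>fst p' \<le> snd p \<le> fst (succ p)\<close>, and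
    different first components are incomparable.\<close>
  have meet: "p' = succ p" if p: "p \<in> set S" "p' \<in> set S" "f (snd p) = f (fst p')" for p p'
    using comp[OF inX(2)[OF p(1)] inX(1)[OF p(2)] p(3)]
  proof
    assume "(snd p, fst p') \<in> r"
    then show ?thesis using succ p by blast
  next
    assume "(fst p', snd p) \<in> r"
    then have "(fst p', fst (succ p)) \<in> r" using succ_r[OF p(1)] r(1) by (metis transD)
    then show ?thesis using strict_alternating_cycle_fst_eqI[OF S r(1)] p succ(1) by blast
  qed
  define b where "b p = (if f (snd p) = f (fst (succ p)) then [p]
    else [p, (snd p, fst (succ p))])" for p
  define S' where "S' = concat (map b S)"
  have b_ne: "b p \<noteq> []" for p by (simp add: b_def)
  have S'_set: "set S' = (\<Union>p\<in>set S. set (b p))" by (simp add: S'_def)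
  have S'_ne: "S' \<noteq> []" using S_ne b_ne by (cases S) (auto simp: S'_def)
  have inc: "set S' \<subseteq> incomparable_pairs X q"
  proof
    fix p' assume "p' \<in> set S'"
    then obtain p where p: "p \<in> set S" "p' \<in> set (b p)" by (auto simp: S'_set)
    have "p' = p \<or> p' = (snd p, fst (succ p)) \<and> f (snd p) \<noteq> f (fst (succ p))"
      using p by (auto simp: b_def split: if_splits)
    then show "p' \<in> incomparable_pairs X q"
      using p(1) S_inc inX[OF p(1)] inX[OF succ(1)[OF p(1)]]
      by (elim disjE) (auto simp: incomparable_pairs_def q_def)
  qed
  define R where "R p p' \<longleftrightarrow> (snd p, fst p') \<in> q" for p p' :: "'a \<times> 'a"
  have hd_b: "hd (b p) = p" for p by (simp add: b_def)
  have diag: "(x, x) \<in> q" if "x \<in> X" for x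
    using that r(2) by (simp add: q_def refl_on_def)
  have link: "R (last (b p)) (hd (b (succ p)))" if p: "p \<in> set S" for p
    unfolding hd_b using succ_r[OF p] diag[OF inX(1)[OF succ(1)[OF p]]]
    by (simp add: b_def R_def q_def)
  have inner: "successively R (b p)" if p: "p \<in> set S" for p
    using diag[OF inX(2)[OF p]] by (simp add: b_def R_def)
  have "\<forall>i<length S. R (last (b (S ! i))) (hd (b (S ! (Suc i mod length S))))"
    using link succ(4) by (metis nth_mem)
  then have "successively (\<lambda>p p'. R (last (b p)) (hd (b p'))) S"
    "R (last (b (last S))) (hd (b (hd S)))"
    using all_cyclic_successive_iff[OF S_ne, of "\<lambda>p p'. R (last (b p)) (hd (b p'))"] by blast+
  moreover have "hd S' = hd (b (hd S))"
    using S_ne b_ne unfolding S'_def by (cases S) auto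
  moreover have "last S' = last (b (last S))"
    using S_ne b_ne unfolding S'_def by (cases S rule: rev_cases) auto
  ultimately have "successively R S' \<and> R (last S') (hd S')"
    unfolding S'_def using inner b_ne by (auto intro: successively_concat)
  then have alt: "alternating_cycle X q S'"
    using all_cyclic_successive_iff[OF S'_ne, of R] S'_ne inc
    by (simp add: alternating_cycle_def R_def)
  have "distinct (concat (map (\<lambda>p. map (f \<circ> fst) (b p)) S))"
  proof (rule distinct_concat_map)
    show "distinct S" by (rule strict_alternating_cycle_distinct[OF S])
    show "distinct (map (f \<circ> fst) (b p))" if "p \<in> set S" for p
      using meet[OF that that] by (auto simp: b_def)
    show "set (map (f \<circ> fst) (b p)) \<inter> set (map (f \<circ> fst) (b p')) = {}"
      if p: "p \<in> set S" "p' \<in> set S" "p \<noteq> p'" for p p'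
      using fst_inj[OF p(1,2)] snd_inj[OF p(1,2)] meet[OF p(1,2)] meet[OF p(2,1)] p(3)
      by (auto simp: b_def)
  qed
  then have "distinct (map (f \<circ> fst) S')" by (simp add: S'_def map_concat comp_def)
  then have "strict_alternating_cycle X q S'"
    by (intro strict_alternating_cycleI[OF alt]) (auto simp: q_def)
  moreover have "set S' \<inter> incomparable_pairs X r = set S"
  proof
    show "set S \<subseteq> set S' \<inter> incomparable_pairs X r"
      using S_inc by (auto simp: S'_set b_def)
    show "set S' \<inter> incomparable_pairs X r \<subseteq> set S"
      using succ_r by (auto simp: S'_set b_def incomparable_pairs_def split: if_splits)
  qed
  ultimately show ?thesis unfolding q_def by blast
qed

text \<open>Each cycle of \<open>r\<close> arises from a cycle of the union of the chains by keeping the pairs that are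
  incomparable in \<open>r\<close>.\<close>

lemma card_strict_alternating_cycles_le_refine:
  assumes po: "partial_order_on X r" and fin: "finite X"
    and comp: "\<And>x y. x \<in> X \<Longrightarrow> y \<in> X \<Longrightarrow> f x = f y \<Longrightarrow> (x, y) \<in> r \<or> (y, x) \<in> r"
  shows "card (strict_alternating_cycles X r)
    \<le> card (strict_alternating_cycles X {(x, y) \<in> r. f x = f y})"
  unfolding card_strict_alternating_cycles_eq
proof (rule surj_card_le)
  show "finite (set ` {S. strict_alternating_cycle X {(x, y) \<in> r. f x = f y} S})"
    by (rule finite_sets_of_strict_alternating_cycles[OF fin])
  show "set ` {S. strict_alternating_cycle X r S} \<subseteq>
    (\<lambda>\<sigma>. \<sigma> \<inter> incomparable_pairs X r)
      ` (set ` {S. strict_alternating_cycle X {(x, y) \<in> r. f x = f y} S})"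
  proof (rule image_subsetI)
    fix S assume "S \<in> {S. strict_alternating_cycle X r S}"
    then have "strict_alternating_cycle X r S" ..
    from strict_alternating_cycle_refine[OF po comp this]
    obtain S' where S': "strict_alternating_cycle X {(x, y) \<in> r. f x = f y} S'"
      "set S' \<inter> incomparable_pairs X r = set S" by auto
    show "set S \<in> (\<lambda>\<sigma>. \<sigma> \<inter> incomparable_pairs X r)
      ` (set ` {S. strict_alternating_cycle X {(x, y) \<in> r. f x = f y} S})"
      unfolding S'(2)[symmetric] by (intro imageI) (use S'(1) in simp)
  qed
qed

section \<open>Disjoint unions of chains\<close>

text \<open>The number of cyclic orders of a set with \<open>k\<close> elements, set to \<open>0\<close> for \<open>k < 2\<close> because a
  cycle visits at least two chains.\<close>

definition cyclic_orders :: "nat \<Rightarrow> nat" where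
  "cyclic_orders k = (if k < 2 then 0 else fact (k - 1))"

text \<open>The number of intervals \<open>x \<le> y\<close> in a chain with \<open>c\<close> elements.\<close>

definition triangular :: "nat \<Rightarrow> nat" where
  "triangular c = c * (c + 1) div 2"

text \<open>The elementary symmetric polynomials of \<open>t\<close>, added up with the weight \<open>z k\<close> in degree \<open>k\<close>. An
  arbitrary weight is allowed since splitting off a variable shifts it.\<close>

definition subset_product_sum :: "(nat \<Rightarrow> nat) \<Rightarrow> 'c set \<Rightarrow> ('c \<Rightarrow> nat) \<Rightarrow> nat" where
  "subset_product_sum z I t = (\<Sum>K\<in>Pow I. z (card K) * prod t K)"

lemma card_permutations_with_head:
  assumes "finite K" "h \<in> K"
  shows "card {L \<in> permutations_of_set K. hd L = h} = fact (card K - 1)"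
proof -
  have "{L \<in> permutations_of_set K. hd L = h} = (#) h ` permutations_of_set (K - {h})"
    using assms by (subst permutations_of_set_nonempty) auto
  then show ?thesis using assms by (simp add: card_image)
qed

text \<open>The pairs \<open>x \<le> y\<close> and the pairs \<open>x \<ge> y\<close> are equally many, cover \<open>C \<times> C\<close>, and overlap in
  the diagonal.\<close>

lemma card_comparable_pairs_of_chain:
  assumes "finite C" and po: "partial_order_on X r" and "C \<subseteq> X"
    and total: "\<And>x y. x \<in> C \<Longrightarrow> y \<in> C \<Longrightarrow> (x, y) \<in> r \<or> (y, x) \<in> r"
  shows "card (r \<inter> C \<times> C) = triangular (card C)"
proof -
  have r: "antisym r" "refl_on X r"
    using po by (auto simp: partial_order_on_def preorder_on_def)
  let ?A = "r \<inter> C \<times> C" and ?B = "r\<inverse> \<inter> C \<times> C"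
  have "?B = prod.swap ` ?A" by force
  then have "card ?B = card ?A" by (simp add: card_image)
  moreover have "?A \<union> ?B = C \<times> C" using total by auto
  moreover have "?A \<inter> ?B = (\<lambda>x. (x, x)) ` C"
    using r assms(3) by (auto simp: antisym_def refl_on_def)
  then have "card (?A \<inter> ?B) = card C" by (simp add: card_image inj_on_def)
  moreover have "finite ?A" "finite ?B" using assms(1) by auto
  ultimately have "2 * card ?A = card C * card C + card C"
    using card_Un_Int[of ?A ?B] by (simp add: card_cartesian_product)
  then show ?thesis by (simp add: triangular_def)
qed

text \<open>The cycle that visits the chains in the order \<open>L\<close>, where \<open>g i\<close> is the interval used in the
  chain \<open>i\<close>: it enters the chain at the lower end and leaves it from the upper end, so each pair
  joins the upper end of one interval to the lower end of the next.\<close>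

definition cycle_through :: "'c list \<Rightarrow> ('c \<Rightarrow> 'a \<times> 'a) \<Rightarrow> ('a \<times> 'a) list" where
  "cycle_through L g = zip (map (snd \<circ> g) L) (rotate1 (map (fst \<circ> g) L))"

lemma length_cycle_through [simp]: "length (cycle_through L g) = length L"
  by (simp add: cycle_through_def)

lemma nth_cycle_through:
  assumes "i < length L"
  shows "cycle_through L g ! i = (snd (g (L ! i)), fst (g (L ! (Suc i mod length L))))"
proof -
  have "Suc i mod length L < length L" using assms by (intro mod_less_divisor) auto
  then show ?thesis using assms by (simp add: cycle_through_def nth_rotate1)
qed

lemma cycle_through_rotate: "cycle_through (rotate m L) g = rotate m (cycle_through L g)"
proof (rule nth_equalityI)
  fix i assume "i < length (cycle_through (rotate m L) g)"
  then have i: "i < length L" by simp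
  then have lt: "Suc i mod length L < length L" "(m + i) mod length L < length L"
    by (auto intro: mod_less_divisor)
  have "(m + Suc i mod length L) mod length L = Suc ((m + i) mod length L) mod length L"
    by (simp add: mod_add_right_eq mod_Suc_eq)
  then show "cycle_through (rotate m L) g ! i = rotate m (cycle_through L g) ! i"
    using i lt by (simp add: nth_cycle_through nth_rotate)
qed simp

text \<open>The hypothesis says that the chains are the fibres of \<open>f\<close> and that there are no comparabilities
  between them. Each cyclic order of a set \<open>K\<close> of chains is represented by the list that starts with a
  chosen element of \<open>K\<close>, so that cycles correspond bijectively to a set \<open>K\<close>, such a list, and a
  choice of an interval in each chain of \<open>K\<close>.\<close>

lemma card_strict_alternating_cycles_chain_union:
  fixes f :: "'a \<Rightarrow> 'c"
  assumes po: "partial_order_on X r" and fin: "finite X"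
    and comp: "\<And>x y. x \<in> X \<Longrightarrow> y \<in> X \<Longrightarrow> f x = f y \<longleftrightarrow> (x, y) \<in> r \<or> (y, x) \<in> r"
  shows "card (strict_alternating_cycles X r)
    = subset_product_sum cyclic_orders (f ` X) (\<lambda>i. triangular (card {x \<in> X. f x = i}))"
proof -
  have r: "trans r" "refl_on X r" "r \<subseteq> X \<times> X"
    using po by (auto simp: partial_order_on_def preorder_on_def)
  have r_f: "f x = f y" if "(x, y) \<in> r" for x y using comp that r(3) by blast
  define T where "T i = r \<inter> {x \<in> X. f x = i} \<times> {x \<in> X. f x = i}" for i
  have card_T: "card (T i) = triangular (card {x \<in> X. f x = i})" for i
    unfolding T_def using fin comp by (intro card_comparable_pairs_of_chain[OF _ po]) auto
  have fin_T: "finite (T i)" for i using fin by (auto simp: T_def)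
  have T_D: "fst d \<in> X" "snd d \<in> X" "d \<in> r" "f (fst d) = i" "f (snd d) = i" if "d \<in> T i" for d i
    using that by (auto simp: T_def)
  have T_I: "(x, y) \<in> T (f y)" if "(x, y) \<in> r" for x y
    using that r(3) r_f[OF that] by (auto simp: T_def)
  define h where "h K = (SOME i. i \<in> K)" for K :: "'c set"
  have h: "h K \<in> K" if "K \<noteq> {}" for K
    using that unfolding h_def by (simp add: some_in_eq)
  define Ks where "Ks = {K. K \<subseteq> f ` X \<and> 2 \<le> card K}"
  have Ks: "finite K" "K \<noteq> {}" "2 \<le> card K" "K \<subseteq> f ` X" if "K \<in> Ks" for K
    using that fin finite_subset[of K "f ` X"] by (auto simp: Ks_def)
  define D where
    "D = (SIGMA K:Ks. {L \<in> permutations_of_set K. hd L = h K} \<times> (\<Pi>\<^sub>E i\<in>K. T i))"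
  define F where "F = (\<lambda>(K :: 'c set, L :: 'c list, g). set (cycle_through L g) :: ('a \<times> 'a) set)"
  have chains: "map (f \<circ> fst) (cycle_through L g) = L" if "g \<in> (\<Pi>\<^sub>E i\<in>set L. T i)" for L g
  proof (rule nth_equalityI)
    fix i assume "i < length (map (f \<circ> fst) (cycle_through L g))"
    then show "map (f \<circ> fst) (cycle_through L g) ! i = L ! i"
      using that T_D(5) by (simp add: nth_cycle_through PiE_mem)
  qed simp
  have strict: "strict_alternating_cycle X r (cycle_through L g)"
    if L: "distinct L" "2 \<le> length L" and g: "g \<in> (\<Pi>\<^sub>E i\<in>set L. T i)" for L g
  proof (rule strict_alternating_cycleI[where f = f])
    show "distinct (map (f \<circ> fst) (cycle_through L g))" using chains[OF g] L(1) by simp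
    have gT: "g i \<in> T i" if "i \<in> set L" for i using g that by (rule PiE_mem)
    show "alternating_cycle X r (cycle_through L g)"
      unfolding alternating_cycle_def
    proof (intro conjI allI impI)
      show "cycle_through L g \<noteq> []" using L(2) by (metis length_cycle_through list.size(3) not_numeral_le_zero)
      show "set (cycle_through L g) \<subseteq> incomparable_pairs X r"
      proof
        fix p assume "p \<in> set (cycle_through L g)"
        then obtain i where i: "i < length L" "p = cycle_through L g ! i"
          by (auto simp: in_set_conv_nth)
        let ?j = "Suc i mod length L"
        have j: "?j < length L" using i(1) by (intro mod_less_divisor) auto
        have "?j \<noteq> i" using L(2) i(1) by (cases "Suc i = length L") auto
        then have ne: "L ! i \<noteq> L ! ?j" using L(1) i(1) j by (simp add: nth_eq_iff_index_eq)
        have "fst p = snd (g (L ! i))" "snd p = fst (g (L ! ?j))"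
          using i by (simp_all add: nth_cycle_through)
        then have "fst p \<in> X" "snd p \<in> X" "f (fst p) = L ! i" "f (snd p) = L ! ?j"
          using T_D[OF gT[OF nth_mem[OF i(1)]]] T_D[OF gT[OF nth_mem[OF j]]] by simp_all
        then show "p \<in> incomparable_pairs X r"
          using ne r_f[of "fst p" "snd p"] r_f[of "snd p" "fst p"]
          by (auto simp: incomparable_pairs_def case_prod_beta)
      qed
      fix i assume "i < length (cycle_through L g)"
      then have i: "i < length L" by simp
      let ?j = "Suc i mod length L"
      have j: "?j < length L" using i by (intro mod_less_divisor) auto
      have "g (L ! ?j) \<in> r" using T_D(3)[OF gT[OF nth_mem[OF j]]] .
      then show "(snd (cycle_through L g ! i), fst (cycle_through L g ! (Suc i mod length (cycle_through L g)))) \<in> r"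
        using i j by (simp add: nth_cycle_through)
    qed
  qed (rule r_f)
  have D_E: "K = set L" "distinct L" "2 \<le> length L" "hd L = h (set L)"
    "g \<in> (\<Pi>\<^sub>E i\<in>set L. T i)" if "(K, L, g) \<in> D" for K L g
    using that Ks(3)[of K] distinct_card[of L] by (auto simp: D_def permutations_of_set_def)
  have "inj_on F D"
  proof (rule inj_onI)
    fix x y assume xy: "x \<in> D" "y \<in> D" "F x = F y"
    obtain K L g where x: "x = (K, L, g)" by (cases x)
    obtain K' L' g' where y: "y = (K', L', g')" by (cases y)
    note Lg = D_E[OF xy(1)[unfolded x]] and Lg' = D_E[OF xy(2)[unfolded y]]
    obtain m where m: "cycle_through L' g' = rotate m (cycle_through L g)"
      using rotate_of_same_set_strict_alternating_cycles[OF strict[OF Lg(2,3,5)] strict[OF Lg'(2,3,5)]]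
        xy(3) by (auto simp: F_def x y)
    have "L' = rotate m L"
      using arg_cong[OF m, of "map (f \<circ> fst)"] chains[OF Lg(5)] chains[OF Lg'(5)]
      by (simp flip: rotate_map)
    then have "set L' = set L" by simp
    have L0: "L \<noteq> []" using Lg(3) by auto
    \<comment> \<open>Both lists start with the chosen chain, so the rotation between them is trivial.\<close>
    have "L ! (m mod length L) = L ! 0"
      using Lg(4) Lg'(4) \<open>set L' = set L\<close> \<open>L' = rotate m L\<close> L0
      by (metis hd_conv_nth hd_rotate_conv_nth)
    then have "m mod length L = 0"
      using nth_eq_iff_index_eq[OF Lg(2)] L0 by simp
    then have "rotate m L = L" "rotate m (cycle_through L g) = cycle_through L g"
      by (metis rotate_conv_mod rotate0 id_apply, metis rotate_conv_mod rotate0 id_apply length_cycle_through)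
    then have LL: "L' = L" and cc: "cycle_through L g' = cycle_through L g"
      using \<open>L' = rotate m L\<close> m by simp_all
    have "map (snd \<circ> g') L = map (snd \<circ> g) L"
      using arg_cong[OF cc, of "map fst"] by (simp add: cycle_through_def)
    moreover have "rotate1 (map (fst \<circ> g') L) = rotate1 (map (fst \<circ> g) L)"
      using arg_cong[OF cc, of "map snd"] by (simp add: cycle_through_def)
    then have "map (fst \<circ> g') L = map (fst \<circ> g) L" by (metis inj_rotate1 injD)
    ultimately have "g' i = g i" if "i \<in> set L" for i
      using that by (simp add: prod_eq_iff)
    then have "g' = g" using Lg(5) Lg'(5) unfolding LL by (metis PiE_ext)
    then show "x = y" using x y LL Lg(1) Lg'(1) by simp
  qed
  moreover have "F ` D = set ` {S. strict_alternating_cycle X r S}"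
  proof
    show "F ` D \<subseteq> set ` {S. strict_alternating_cycle X r S}"
    proof
      fix \<sigma> assume "\<sigma> \<in> F ` D"
      then obtain K L g where x: "(K, L, g) \<in> D" "\<sigma> = set (cycle_through L g)"
        by (auto simp: F_def)
      show "\<sigma> \<in> set ` {S. strict_alternating_cycle X r S}"
        unfolding x(2) using strict[OF D_E(2,3,5)[OF x(1)]] by blast
    qed
  next
    show "set ` {S. strict_alternating_cycle X r S} \<subseteq> F ` D"
    proof (rule image_subsetI)
      fix S assume "S \<in> {S. strict_alternating_cycle X r S}"
      then have S: "strict_alternating_cycle X r S" ..
      have S_ne: "S \<noteq> []" and S_inc: "set S \<subseteq> incomparable_pairs X r"
        using S by (auto simp: strict_alternating_cycle_def alternating_cycle_def)
      have inX: "fst p \<in> X" "snd p \<in> X" if "p \<in> set S" for p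
        using S_inc that by (auto simp: incomparable_pairs_def)
      define succ where "succ = succ_pair r S"
      note succ = strict_alternating_cycle_succ_pair[OF S, folded succ_def]
      have fst_inj: "p = p'" if "p \<in> set S" "p' \<in> set S" "f (fst p) = f (fst p')" for p p'
        using comp[OF inX(1) inX(1)] strict_alternating_cycle_fst_eqI[OF S r(1)] that by metis
      define L where "L = map (f \<circ> fst) S"
      have L: "distinct L" "length L = length S"
        using strict_alternating_cycle_distinct[OF S] fst_inj
        by (auto simp: L_def distinct_map inj_on_def)
      \<comment> \<open>The interval used in the chain \<open>i\<close> ends at the first component in that chain and
        starts at the second component of the preceding pair \<open>pre i\<close>.\<close>
      define pre where "pre i = (THE p. p \<in> set S \<and> f (fst (succ p)) = i)" for i
      have pre: "pre (f (fst (succ p))) = p" if "p \<in> set S" for p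
        unfolding pre_def
      proof (rule the_equality)
        fix p' assume p': "p' \<in> set S \<and> f (fst (succ p')) = f (fst (succ p))"
        then have "succ p' = succ p" using fst_inj succ(1) that by blast
        then show "p' = p" using succ(3) p' that by (metis bij_betw_def inj_onD)
      qed (use that in simp)
      define g where "g = (\<lambda>i\<in>set L. (snd (pre i), fst (succ (pre i))))"
      have g: "g (f (fst (succ p))) = (snd p, fst (succ p))" if "p \<in> set S" for p
        using pre[OF that] succ(1)[OF that] by (simp add: g_def L_def)
      have g_T: "g \<in> (\<Pi>\<^sub>E i\<in>set L. T i)"
      proof (rule PiE_I)
        fix i assume "i \<in> set L"
        then obtain q where q: "q \<in> set S" "i = f (fst q)" by (auto simp: L_def)
        have "q \<in> succ ` set S" using succ(3) q(1) by (simp add: bij_betw_def)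
        then obtain p where p: "p \<in> set S" "i = f (fst (succ p))" using q(2) by blast
        have "(snd p, fst (succ p)) \<in> r" using succ p(1) by blast
        then show "g i \<in> T i" unfolding p(2) g[OF p(1)] by (rule T_I)
      qed (simp add: g_def)
      have cyc: "cycle_through L g = S"
      proof (rule nth_equalityI)
        fix i assume "i < length (cycle_through L g)"
        then have i: "i < length S" by (simp add: L)
        let ?j = "Suc i mod length S"
        have j: "?j < length S" using i by (intro mod_less_divisor) auto
        have Si: "S ! i \<in> set S" using i by simp
        have "S ! i \<in> succ ` set S" using succ(3) i by (simp add: bij_betw_def)
        then obtain p where p: "p \<in> set S" "S ! i = succ p" by blast
        have "snd (g (L ! i)) = fst (S ! i)" using g[OF p(1)] i p(2) by (simp add: L_def)
        moreover have "fst (g (L ! ?j)) = snd (S ! i)"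
          using g[OF Si] j succ(4)[OF i] by (simp add: L_def)
        ultimately show "cycle_through L g ! i = S ! i"
          using i L(2) by (simp add: nth_cycle_through)
      qed (simp add: L)
      have len: "2 \<le> length S"
      proof (rule ccontr)
        assume "\<not> 2 \<le> length S"
        moreover have "0 < length S" using S_ne by simp
        ultimately have "length S = 1" by linarith
        then have "(snd (S ! 0), fst (S ! 0)) \<in> r" "S ! 0 \<in> incomparable_pairs X r"
          using S S_inc S_ne by (auto simp: strict_alternating_cycle_def alternating_cycle_def)
        then show False by (auto simp: incomparable_pairs_def)
      qed
      have "set L \<noteq> {}" using S_ne by (simp add: L_def)
      then have "h (set L) \<in> set L" by (rule h)
      then obtain m where m: "m < length L" "L ! m = h (set L)" by (auto simp: in_set_conv_nth)
      then have "hd (rotate m L) = h (set L)"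
        by (subst hd_rotate_conv_nth) auto
      moreover have "set L \<in> Ks"
        using inX(1) len L distinct_card[OF L(1)] by (auto simp: Ks_def L_def)
      ultimately have "(set L, rotate m L, g) \<in> D"
        using L(1) g_T by (auto simp: D_def permutations_of_set_def)
      moreover have "F (set L, rotate m L, g) = set S"
        by (simp add: F_def cycle_through_rotate cyc)
      ultimately show "set S \<in> F ` D" by (metis imageI)
    qed
  qed
  ultimately have "card (strict_alternating_cycles X r) = card D"
    unfolding card_strict_alternating_cycles_eq by (metis card_image)
  also have "\<dots> = (\<Sum>K\<in>Ks. card ({L \<in> permutations_of_set K. hd L = h K} \<times> (\<Pi>\<^sub>E i\<in>K. T i)))"
    unfolding D_def
  proof (rule card_SigmaI)
    show "finite Ks" by (rule finite_subset[of _ "Pow (f ` X)"]) (use fin in \<open>auto simp: Ks_def\<close>)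
    show "\<forall>K\<in>Ks. finite ({L \<in> permutations_of_set K. hd L = h K} \<times> (\<Pi>\<^sub>E i\<in>K. T i))"
      using Ks(1) fin_T by (intro ballI finite_cartesian_product finite_PiE) auto
  qed
  also have "\<dots> = (\<Sum>K\<in>Ks. cyclic_orders (card K) * (\<Prod>i\<in>K. triangular (card {x \<in> X. f x = i})))"
  proof (rule sum.cong)
    fix K assume K: "K \<in> Ks"
    show "card ({L \<in> permutations_of_set K. hd L = h K} \<times> (\<Pi>\<^sub>E i\<in>K. T i))
      = cyclic_orders (card K) * (\<Prod>i\<in>K. triangular (card {x \<in> X. f x = i}))"
      using card_permutations_with_head[OF Ks(1)[OF K] h[OF Ks(2)[OF K]]] Ks[OF K]
      by (simp add: card_cartesian_product card_PiE card_T cyclic_orders_def)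
  qed simp
  also have "\<dots> = subset_product_sum cyclic_orders (f ` X) (\<lambda>i. triangular (card {x \<in> X. f x = i}))"
    unfolding subset_product_sum_def
    by (rule sum.mono_neutral_left) (use fin in \<open>auto simp: Ks_def cyclic_orders_def\<close>)
  finally show ?thesis .
qed

section \<open>Balancing the chain sizes\<close>

lemma two_times_triangular: "2 * triangular c = c * (c + 1)"
  unfolding triangular_def by simp

lemma triangular_Suc: "triangular (Suc c) = triangular c + Suc c"
  using two_times_triangular[of c] two_times_triangular[of "Suc c"] by simp

lemma subset_product_sum_insert:
  assumes "finite I" "i \<notin> I"
  shows "subset_product_sum z (insert i I) t
    = subset_product_sum z I t + t i * subset_product_sum (\<lambda>k. z (Suc k)) I t"
proof -
  have inj: "inj_on (insert i) (Pow I)"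
    using assms(2) by (auto simp: inj_on_def)
  have "subset_product_sum z (insert i I) t = subset_product_sum z I t
      + (\<Sum>K\<in>insert i ` Pow I. z (card K) * prod t K)"
    unfolding subset_product_sum_def Pow_insert
    by (rule sum.union_disjoint) (use assms in auto)
  also have "(\<Sum>K\<in>insert i ` Pow I. z (card K) * prod t K)
      = (\<Sum>K\<in>Pow I. z (card (insert i K)) * prod t (insert i K))"
    by (subst sum.reindex[OF inj]) simp
  also have "\<dots> = (\<Sum>K\<in>Pow I. t i * (z (Suc (card K)) * prod t K))"
  proof (rule sum.cong)
    fix K assume "K \<in> Pow I"
    then have "finite K" "i \<notin> K" using assms finite_subset by auto
    then show "z (card (insert i K)) * prod t (insert i K) = t i * (z (Suc (card K)) * prod t K)"
      by simp
  qed simp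
  finally show ?thesis by (simp add: subset_product_sum_def sum_distrib_left)
qed

lemma subset_product_sum_mono:
  assumes "\<And>k. z k \<le> z' k"
  shows "subset_product_sum z I t \<le> subset_product_sum z' I t"
  unfolding subset_product_sum_def by (intro sum_mono mult_right_mono assms) simp

lemma subset_product_sum_cong:
  assumes "\<And>i. i \<in> I \<Longrightarrow> t i = u i"
  shows "subset_product_sum z I t = subset_product_sum z I u"
  unfolding subset_product_sum_def
  by (intro sum.cong arg_cong2[of _ _ _ _ "(*)"] prod.cong) (use assms in auto)

lemma subset_product_sum_reindex:
  assumes "bij_betw \<pi> I J"
  shows "subset_product_sum z I (\<lambda>i. u (\<pi> i)) = subset_product_sum z J u"
proof -
  have "subset_product_sum z J u = (\<Sum>K\<in>Pow I. z (card (\<pi> ` K)) * prod u (\<pi> ` K))"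
    unfolding subset_product_sum_def
    by (rule sum.reindex_bij_betw[OF bij_betw_Pow[OF assms], symmetric])
  also have "\<dots> = subset_product_sum z I (\<lambda>i. u (\<pi> i))"
    unfolding subset_product_sum_def
  proof (rule sum.cong)
    fix K assume "K \<in> Pow I"
    then have "inj_on \<pi> K" using assms by (auto simp: bij_betw_def intro: inj_on_subset)
    then show "z (card (\<pi> ` K)) * prod u (\<pi> ` K) = z (card K) * (\<Prod>i\<in>K. u (\<pi> i))"
      by (simp add: card_image prod.reindex)
  qed simp
  finally show ?thesis by simp
qed

text \<open>The effect of moving one element from a chain with \<open>m + 1\<close> elements to one with \<open>c2\<close>: the sum of
  the interval numbers drops by \<open>m - c2\<close>, while the product grows by
  \<open>(m + 1) (c2 + 1) (m - c2) / 2\<close>, which is at least as much because \<open>m \<ge> 1\<close>.\<close>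

lemma triangular_balance:
  assumes "c2 < m"
  shows "triangular (Suc m) + triangular c2 = triangular m + triangular (Suc c2) + (m - c2)"
    and "triangular (Suc m) * triangular c2 + (m - c2) \<le> triangular m * triangular (Suc c2)"
proof -
  show "triangular (Suc m) + triangular c2 = triangular m + triangular (Suc c2) + (m - c2)"
    using assms by (simp add: triangular_Suc)
  obtain d where d: "m = c2 + d" "d \<ge> 1" using assms less_imp_add_positive[of c2 m] by force
  have "2 * (triangular m * (c2 + 1)) = (m + 1) * (c2 + 1) * m"
    using two_times_triangular[of m] by (simp add: algebra_simps)
  also have "\<dots> = (m + 1) * (c2 + 1) * c2 + (m + 1) * (c2 + 1) * d"
    by (simp add: d(1) algebra_simps)
  also have "(m + 1) * (c2 + 1) * c2 = 2 * ((m + 1) * triangular c2)"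
    using two_times_triangular[of c2] by (simp add: algebra_simps)
  finally have *: "2 * (triangular m * (c2 + 1))
      = 2 * ((m + 1) * triangular c2) + (m + 1) * (c2 + 1) * d" .
  have "2 * 1 * d \<le> (m + 1) * (c2 + 1) * d"
    using d by (intro mult_right_mono mult_mono) auto
  then have "(m + 1) * triangular c2 + d \<le> triangular m * (c2 + 1)" using * by linarith
  then show "triangular (Suc m) * triangular c2 + (m - c2) \<le> triangular m * triangular (Suc c2)"
    by (simp add: triangular_Suc d(1) algebra_simps)
qed

lemma cyclic_orders_Suc_mono: "cyclic_orders (Suc k) \<le> cyclic_orders (Suc (Suc k))"
  by (auto simp: cyclic_orders_def intro: fact_mono)

text \<open>With \<open>S1\<close> and \<open>S2\<close> the weighted sums over the other chains for sets that contain exactly one or both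
  of \<open>i\<close> and \<open>j\<close>, the quantity is \<open>S + (p + q) S1 + p q S2\<close> with \<open>p\<close> and \<open>q\<close> the interval numbers of \<open>i\<close>
  and \<open>j\<close>. As larger sets do not have smaller weights, \<open>S1 \<le> S2\<close>, and the loss in \<open>p + q\<close> is made up for by the gain in \<open>p q\<close>.\<close>

lemma subset_product_sum_balance:
  assumes "finite I" and ij: "i \<in> I" "j \<in> I" and lt: "g j + 1 < g i"
  shows "subset_product_sum cyclic_orders I (\<lambda>x. triangular (g x))
    \<le> subset_product_sum cyclic_orders I (\<lambda>x. triangular ((g(i := g i - 1, j := g j + 1)) x))"
proof -
  let ?z = cyclic_orders and ?h = "g(i := g i - 1, j := g j + 1)"
  define R where "R = I - {i, j}"
  have ne: "i \<noteq> j" using lt by auto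
  have R: "finite R" "j \<notin> R" "i \<notin> insert j R" "I = insert i (insert j R)"
    using assms ne by (auto simp: R_def)
  define S where "S t = subset_product_sum ?z R t" for t
  define S1 where "S1 t = subset_product_sum (\<lambda>k. ?z (Suc k)) R t" for t
  define S2 where "S2 t = subset_product_sum (\<lambda>k. ?z (Suc (Suc k))) R t" for t
  have expand: "subset_product_sum ?z I t = S t + (t i + t j) * S1 t + t i * t j * S2 t" for t
    using R by (simp add: subset_product_sum_insert S_def S1_def S2_def algebra_simps)
  let ?t = "\<lambda>x. triangular (g x)" and ?u = "\<lambda>x. triangular (?h x)"
  have same: "?u x = ?t x" if "x \<in> R" for x using that by (auto simp: R_def)
  have eq: "S ?u = S ?t" "S1 ?u = S1 ?t" "S2 ?u = S2 ?t"
    unfolding S_def S1_def S2_def by (intro subset_product_sum_cong same; simp)+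
  have le: "S1 ?t \<le> S2 ?t"
    unfolding S1_def S2_def by (rule subset_product_sum_mono) (rule cyclic_orders_Suc_mono)
  obtain m where m: "g i = Suc m" "g j < m" using lt by (cases "g i") auto
  define d where "d = m - g j"
  have u: "?u i = triangular m" "?u j = triangular (Suc (g j))" using m ne by simp_all
  note bal = triangular_balance[OF m(2), folded m(1) d_def]
  have "(?t i + ?t j) * S1 ?t + ?t i * ?t j * S2 ?t
      = (?u i + ?u j) * S1 ?t + d * S1 ?t + ?t i * ?t j * S2 ?t"
    unfolding bal(1) u by (simp add: algebra_simps)
  also have "\<dots> \<le> (?u i + ?u j) * S1 ?t + (?t i * ?t j + d) * S2 ?t"
    using le by (simp add: algebra_simps)
  also have "\<dots> \<le> (?u i + ?u j) * S1 ?t + ?u i * ?u j * S2 ?t"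
    unfolding u using bal(2) by (intro add_left_mono mult_right_mono) auto
  finally show ?thesis unfolding expand eq by simp
qed

text \<open>Each balancing move lowers the sum of the squares, so the moves come to an end.\<close>

lemma exists_balanced:
  assumes "finite I"
  shows "\<exists>h. sum h I = sum g I \<and> (\<forall>i\<in>I. \<forall>j\<in>I. h i \<le> h j + 1) \<and>
    subset_product_sum cyclic_orders I (\<lambda>x. triangular (g x))
      \<le> subset_product_sum cyclic_orders I (\<lambda>x. triangular (h x))"
proof (induction "\<Sum>i\<in>I. (g i)\<^sup>2" arbitrary: g rule: less_induct)
  case less
  show ?case
  proof (cases "\<forall>i\<in>I. \<forall>j\<in>I. g i \<le> g j + 1")
    case True
    then show ?thesis by blast
  next
    case False
    then obtain i j where ij: "i \<in> I" "j \<in> I" "g j + 1 < g i" by (metis not_le)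
    define h where "h = g(i := g i - 1, j := g j + 1)"
    have ne: "j \<noteq> i" using ij by auto
    have split: "sum t I = t i + (t j + sum t (I - {i} - {j}))" for t :: "_ \<Rightarrow> nat"
      using assms ij ne by (simp add: sum.remove)
    have rest: "sum (\<lambda>x. F (h x)) (I - {i} - {j}) = sum (\<lambda>x. F (g x)) (I - {i} - {j})"
      for F :: "nat \<Rightarrow> nat"
      by (intro sum.cong) (auto simp: h_def)
    obtain m where m: "g i = Suc m" "g j < m" using ij by (cases "g i") auto
    have hij: "h i = m" "h j = Suc (g j)" using ne m by (simp_all add: h_def)
    have "(\<Sum>i\<in>I. (h i)\<^sup>2) < (\<Sum>i\<in>I. (g i)\<^sup>2)"
      unfolding split[of "\<lambda>x. (h x)\<^sup>2"] split[of "\<lambda>x. (g x)\<^sup>2"] rest[of "\<lambda>c. c\<^sup>2"] hij m(1)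
      using m(2) by (simp add: power2_eq_square)
    from less[OF this] obtain h' where h': "sum h' I = sum h I"
      "\<forall>i\<in>I. \<forall>j\<in>I. h' i \<le> h' j + 1"
      "subset_product_sum cyclic_orders I (\<lambda>x. triangular (h x))
        \<le> subset_product_sum cyclic_orders I (\<lambda>x. triangular (h' x))" by blast
    have "sum h I = sum g I"
      unfolding split[of h] split[of g] hij m(1) using rest[of "\<lambda>x. x"] by simp
    moreover have "subset_product_sum cyclic_orders I (\<lambda>x. triangular (g x))
        \<le> subset_product_sum cyclic_orders I (\<lambda>x. triangular (h x))"
      unfolding h_def by (rule subset_product_sum_balance[OF assms ij])
    ultimately show ?thesis using h' by (metis order_trans)
  qed
qed

text \<open>If \<open>m\<close> is the least value and \<open>H\<close> the set of members with the value \<open>m + 1\<close>, the sum is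
  \<open>|I| m + |H|\<close> with \<open>|H| < |I|\<close>, a division with remainder.\<close>

lemma balanced_values:
  fixes g :: "'c \<Rightarrow> nat"
  assumes fin: "finite I" and "I \<noteq> {}" and bal: "\<forall>i\<in>I. \<forall>j\<in>I. g i \<le> g j + 1"
  defines "d \<equiv> sum g I div card I"
  shows "\<forall>i\<in>I. g i = d \<or> g i = d + 1"
    and "card {i \<in> I. g i = d + 1} = sum g I mod card I"
proof -
  have "Min (g ` I) \<in> g ` I" using assms by (intro Min_in) auto
  then obtain i0 where i0: "i0 \<in> I" "g i0 = Min (g ` I)" by force
  define m where "m = g i0"
  define H where "H = {i \<in> I. g i = m + 1}"
  have m: "g i = m \<or> g i = m + 1" if "i \<in> I" for i
  proof -
    have "m \<le> g i" using fin that by (simp add: m_def i0(2))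
    moreover have "g i \<le> m + 1" using bal i0(1) that by (simp add: m_def)
    ultimately show ?thesis by linarith
  qed
  have "sum g I = (\<Sum>i\<in>I. m + (if i \<in> H then 1 else 0))"
    using m by (intro sum.cong) (auto simp: H_def)
  also have "\<dots> = card I * m + card H"
    using fin by (simp add: sum.distrib H_def flip: sum.inter_filter)
  finally have total: "sum g I = card I * m + card H" .
  have "i0 \<notin> H" by (simp add: H_def m_def)
  then have "H \<subset> I" using i0(1) by (auto simp: H_def)
  then have "card H < card I" using fin by (rule psubset_card_mono[rotated])
  then have "d = m" "sum g I mod card I = card H"
    unfolding d_def total by simp_all
  then show "\<forall>i\<in>I. g i = d \<or> g i = d + 1"
    "card {i \<in> I. g i = d + 1} = sum g I mod card I"
    using m by (auto simp: H_def)
qed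

text \<open>The members with the value \<open>d + 1\<close> are matched with each other, and so are the remaining
  ones, which are equally many because \<open>I\<close> and \<open>J\<close> are equally large.\<close>

lemma bij_betw_two_values:
  fixes g :: "'c \<Rightarrow> nat" and h :: "'d \<Rightarrow> nat"
  assumes fin: "finite I" "finite J" and card: "card I = card J"
    and g: "\<forall>i\<in>I. g i = d \<or> g i = d + 1" and h: "\<forall>j\<in>J. h j = d \<or> h j = d + 1"
    and eq: "card {i \<in> I. g i = d + 1} = card {j \<in> J. h j = d + 1}"
  shows "\<exists>\<pi>. bij_betw \<pi> I J \<and> (\<forall>i\<in>I. g i = h (\<pi> i))"
proof -
  define I1 J1 where "I1 = {i \<in> I. g i = d + 1}" and "J1 = {j \<in> J. h j = d + 1}"
  have sub: "I1 \<subseteq> I" "J1 \<subseteq> J" by (auto simp: I1_def J1_def)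
  have fin1: "finite I1" "finite J1" using fin sub finite_subset by auto
  have "card (I - I1) = card (J - J1)"
    using sub fin1 card eq by (simp add: card_Diff_subset I1_def J1_def)
  then obtain \<beta> where \<beta>: "bij_betw \<beta> (I - I1) (J - J1)"
    using fin finite_same_card_bij by blast
  obtain \<alpha> where \<alpha>: "bij_betw \<alpha> I1 J1"
    using fin1 eq finite_same_card_bij by (metis I1_def J1_def)
  define \<pi> where "\<pi> i = (if i \<in> I1 then \<alpha> i else \<beta> i)" for i
  have "bij_betw \<pi> I1 J1" using \<alpha> by (simp add: \<pi>_def cong: bij_betw_cong)
  moreover have "bij_betw \<pi> (I - I1) (J - J1)"
    using \<beta> by (subst bij_betw_cong[of _ _ \<beta>]) (auto simp: \<pi>_def)
  ultimately have "bij_betw \<pi> (I1 \<union> (I - I1)) (J1 \<union> (J - J1))"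
    by (rule bij_betw_combine) auto
  then have "bij_betw \<pi> I J" using sub by (simp add: Un_absorb1)
  moreover have "g i = h (\<pi> i)" if "i \<in> I" for i
  proof (cases "i \<in> I1")
    case True
    then have "\<pi> i \<in> J1" using \<alpha> by (auto simp: \<pi>_def bij_betw_def)
    then show ?thesis using True by (simp add: I1_def J1_def)
  next
    case False
    then have "\<pi> i \<in> J - J1" using \<beta> that by (auto simp: \<pi>_def bij_betw_def)
    then show ?thesis using False that g h by (auto simp: I1_def J1_def)
  qed
  ultimately show ?thesis by blast
qed

lemma subset_product_sum_le_balanced:
  fixes g :: "'c \<Rightarrow> nat" and h :: "'d \<Rightarrow> nat"
  assumes fin: "finite I" "finite J" and card: "card I = card J" and "J \<noteq> {}"
    and sum: "sum g I = n"
    and h: "\<forall>j\<in>J. h j = n div card J \<or> h j = n div card J + 1"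
      "card {j \<in> J. h j = n div card J + 1} = n mod card J"
  shows "subset_product_sum cyclic_orders I (\<lambda>x. triangular (g x))
    \<le> subset_product_sum cyclic_orders J (\<lambda>x. triangular (h x))"
proof -
  have "I \<noteq> {}" using assms by auto
  obtain g' where g': "sum g' I = n" "\<forall>i\<in>I. \<forall>j\<in>I. g' i \<le> g' j + 1"
    and le: "subset_product_sum cyclic_orders I (\<lambda>x. triangular (g x))
      \<le> subset_product_sum cyclic_orders I (\<lambda>x. triangular (g' x))"
    using exists_balanced[OF fin(1), of g] sum by auto
  note val = balanced_values[OF fin(1) \<open>I \<noteq> {}\<close> g'(2), unfolded g'(1) card]
  obtain \<pi> where \<pi>: "bij_betw \<pi> I J" "\<forall>i\<in>I. g' i = h (\<pi> i)"
    using bij_betw_two_values[OF fin card val(1) h(1)] val(2) h(2) by auto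
  have "subset_product_sum cyclic_orders I (\<lambda>x. triangular (g' x))
      = subset_product_sum cyclic_orders I (\<lambda>x. triangular (h (\<pi> x)))"
    using \<pi>(2) by (intro subset_product_sum_cong) simp
  also have "\<dots> = subset_product_sum cyclic_orders J (\<lambda>x. triangular (h x))"
    by (rule subset_product_sum_reindex[OF \<pi>(1)])
  finally show ?thesis using le by simp
qed

section \<open>Dilworth's theorem\<close>

text \<open>An element with the largest number of elements below it is maximal.\<close>

lemma finite_partial_order_maximal:
  assumes po: "partial_order_on X r" and Y: "finite Y" "Y \<noteq> {}" "Y \<subseteq> X"
  shows "\<exists>a\<in>Y. \<forall>y\<in>Y. (a, y) \<in> r \<longrightarrow> y = a"
proof -
  have r: "trans r" "antisym r" "refl_on X r"
    using po by (auto simp: partial_order_on_def preorder_on_def)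
  define d where "d a = card {z \<in> Y. (z, a) \<in> r}" for a
  have "Max (d ` Y) \<in> d ` Y" using Y by (intro Max_in) auto
  then obtain a where a: "a \<in> Y" "d a = Max (d ` Y)" by force
  show ?thesis
  proof (rule bexI[OF _ a(1)], intro ballI impI, rule ccontr)
    fix y assume y: "y \<in> Y" "(a, y) \<in> r" "y \<noteq> a"
    have "(y, y) \<in> r" using r(3) y(1) Y(3) by (auto simp: refl_on_def)
    moreover have "(y, a) \<notin> r" using y r(2) by (metis antisymD)
    moreover have "(z, y) \<in> r" if "(z, a) \<in> r" for z using that y(2) r(1) by (metis transD)
    ultimately have "{z \<in> Y. (z, a) \<in> r} \<subset> {z \<in> Y. (z, y) \<in> r}" using y(1) by blast
    then have "d a < d y" unfolding d_def using Y(1) by (intro psubset_card_mono) auto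
    moreover have "d y \<le> Max (d ` Y)" using Y(1) y(1) by (intro Max_ge) auto
    ultimately show False using a(2) by simp
  qed
qed

text \<open>Galvin's induction. Remove a maximal element \<open>a\<close> and partition the rest into \<open>k\<close> chains, with \<open>k\<close> the
  size of an antichain. In each chain let \<open>t i\<close> be the largest element that lies in some
  antichain of size \<open>k\<close>; these elements form an antichain. If \<open>a\<close> is incomparable to all of them, it
  enlarges this antichain and becomes a chain of its own. Otherwise \<open>a\<close> is above some \<open>t i\<close>, and \<open>a\<close> together
  with the part of chain \<open>i\<close> up to \<open>t i\<close> is a chain that meets every antichain of size \<open>k\<close> in the rest;
  what remains has antichains of size less than \<open>k\<close> only.\<close>

lemma dilworth_colouring:
  assumes po: "partial_order_on X r" and fin: "finite Y" and "Y \<subseteq> X"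
  shows "\<exists>A f. A \<subseteq> Y \<and> (\<forall>x\<in>A. \<forall>y\<in>A. (x, y) \<in> r \<longrightarrow> x = y) \<and>
    f ` Y \<subseteq> {..<card A} \<and> (\<forall>x\<in>Y. \<forall>y\<in>Y. f x = f y \<longrightarrow> (x, y) \<in> r \<or> (y, x) \<in> r)"
  using fin \<open>Y \<subseteq> X\<close>
proof (induction "card Y" arbitrary: Y rule: less_induct)
  case less
  note fin = \<open>finite Y\<close> and YX = \<open>Y \<subseteq> X\<close>
  have r: "trans r" "antisym r" "refl_on X r"
    using po by (auto simp: partial_order_on_def preorder_on_def)
  define indep where "indep A \<longleftrightarrow> (\<forall>x\<in>A. \<forall>y\<in>A. (x, y) \<in> r \<longrightarrow> x = y)" for A
  show ?case
  proof (cases "Y = {}")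
    case True
    then show ?thesis by simp
  next
    case False
    obtain a where a: "a \<in> Y" "\<And>y. y \<in> Y \<Longrightarrow> (a, y) \<in> r \<Longrightarrow> y = a"
      using finite_partial_order_maximal[OF po fin False YX] by metis
    have aa: "(a, a) \<in> r" using r(3) a(1) YX by (auto simp: refl_on_def)
    define Y' where "Y' = Y - {a}"
    have Y': "finite Y'" "Y' \<subseteq> X" "Y' \<subseteq> Y" "card Y' < card Y" "a \<notin> Y'" "Y = insert a Y'"
      using fin YX a(1) card_Diff1_less[OF fin a(1)] by (auto simp: Y'_def)
    from less.hyps[OF Y'(4,1,2)] obtain A f where A: "A \<subseteq> Y'" "indep A"
      and f: "f ` Y' \<subseteq> {..<card A}"
      and comp: "\<And>x y. x \<in> Y' \<Longrightarrow> y \<in> Y' \<Longrightarrow> f x = f y \<Longrightarrow> (x, y) \<in> r \<or> (y, x) \<in> r"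
      unfolding indep_def by metis
    define k where "k = card A"
    have inj: "inj_on f B" if "B \<subseteq> Y'" "indep B" for B
    proof (rule inj_onI)
      fix x y assume xy: "x \<in> B" "y \<in> B" "f x = f y"
      then have "(x, y) \<in> r \<or> (y, x) \<in> r" using comp[of x y] that(1) by blast
      then show "x = y" using that(2) xy(1,2) unfolding indep_def by blast
    qed
    have small: "card B \<le> k" if "B \<subseteq> Y'" "indep B" for B
    proof -
      have "f ` B \<subseteq> {..<k}" using f that(1) by (auto simp: k_def)
      then show ?thesis using card_inj_on_le[OF inj[OF that], of "{..<k}"] by simp
    qed
    have onto: "f ` B = {..<k}" if "B \<subseteq> Y'" "indep B" "card B = k" for B
    proof (rule card_subset_eq)
      show "f ` B \<subseteq> {..<k}" using f that(1) by (auto simp: k_def)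
      show "card (f ` B) = card {..<k}" using card_image[OF inj[OF that(1,2)]] that(3) by simp
    qed simp
    define M where
      "M i = {x \<in> Y'. f x = i \<and> (\<exists>B. B \<subseteq> Y' \<and> indep B \<and> card B = k \<and> x \<in> B)}" for i
    have M_meet: "\<exists>y\<in>B. y \<in> M i" if B: "B \<subseteq> Y'" "indep B" "card B = k" "i < k" for B i
    proof -
      have "i \<in> f ` B" using onto[OF B(1-3)] B(4) by simp
      then obtain y where y: "y \<in> B" "i = f y" by (rule imageE)
      then have "y \<in> M i" using B(1-3) by (auto simp: M_def)
      then show ?thesis using y(1) by blast
    qed
    have "\<exists>x\<in>M i. \<forall>y\<in>M i. (y, x) \<in> r" if "i < k" for i
    proof -
      have "M i \<noteq> {}" using M_meet[OF A _ that] by (auto simp: k_def)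
      moreover have "finite (M i)" "M i \<subseteq> X" using Y' by (auto simp: M_def)
      ultimately obtain x where x: "x \<in> M i" "\<And>y. y \<in> M i \<Longrightarrow> (x, y) \<in> r \<Longrightarrow> y = x"
        using finite_partial_order_maximal[OF po] by metis
      have "(y, x) \<in> r" if "y \<in> M i" for y
      proof -
        have "(x, y) \<in> r \<or> (y, x) \<in> r" using comp[of x y] x(1) that by (simp add: M_def)
        then show ?thesis using x(2)[OF that] by blast
      qed
      then show ?thesis using x(1) by blast
    qed
    then obtain t where t: "\<And>i. i < k \<Longrightarrow> t i \<in> M i"
      "\<And>i y. i < k \<Longrightarrow> y \<in> M i \<Longrightarrow> (y, t i) \<in> r"
      by metis
    have tY: "t i \<in> Y'" "f (t i) = i" if "i < k" for i
      using t(1)[OF that] by (auto simp: M_def)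
    have t_indep: "i = j" if ij: "i < k" "j < k" "(t i, t j) \<in> r" for i j
    proof -
      obtain B where B: "B \<subseteq> Y'" "indep B" "card B = k" "t j \<in> B"
        using t(1)[OF ij(2)] by (auto simp: M_def)
      then obtain y where y: "y \<in> B" "y \<in> M i" using M_meet ij(1) by blast
      then have "(y, t j) \<in> r" using t(2)[OF ij(1)] ij(3) r(1) by (metis transD)
      then have "y = t j" using B y unfolding indep_def by blast
      then show ?thesis using y(2) tY(2)[OF ij(2)] by (simp add: M_def)
    qed
    show ?thesis
    proof (cases "\<exists>i<k. (t i, a) \<in> r")
      case False
      define T where "T = insert a (t ` {..<k})"
      have "inj_on t {..<k}" using tY(2) by (metis inj_on_def lessThan_iff)
      moreover have "a \<notin> t ` {..<k}" using tY(1) Y'(5) by auto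
      ultimately have card_T: "card T = Suc k" by (simp add: T_def card_image)
      have "T \<subseteq> Y" using tY(1) Y'(6) by (auto simp: T_def)
      moreover have "indep T"
        unfolding indep_def T_def using a(2) tY(1) Y'(3,5) t_indep False by blast
      moreover have "(f(a := k)) ` Y \<subseteq> {..<card T}"
        using f Y'(6) by (auto simp: card_T k_def less_Suc_eq)
      moreover have "(x, y) \<in> r \<or> (y, x) \<in> r"
        if xy: "x \<in> Y" "y \<in> Y" "(f(a := k)) x = (f(a := k)) y" for x y
      proof -
        have "f z < k" if "z \<in> Y'" for z using f that by (auto simp: k_def)
        from this[of x] this[of y] have "x = a \<longleftrightarrow> y = a"
          using xy Y'(6) by (auto split: if_splits)
        then show ?thesis using xy Y'(6) comp[of x y] aa by (cases "x = a") auto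
      qed
      ultimately show ?thesis
        unfolding indep_def by (intro exI[of _ T] exI[of _ "f(a := k)"]) simp
    next
      case True
      then obtain i where i: "i < k" "(t i, a) \<in> r" by blast
      define K where "K = insert a {z \<in> Y'. f z = i \<and> (z, t i) \<in> r}"
      have below_a: "(z, a) \<in> r" if "z \<in> K" for z
        using that aa transD[OF r(1) _ i(2), of z] by (auto simp: K_def)
      have K_chain: "(x, y) \<in> r \<or> (y, x) \<in> r" if xy: "x \<in> K" "y \<in> K" for x y
      proof (cases "x = a \<or> y = a")
        case True
        then show ?thesis using below_a xy by blast
      next
        case False
        then show ?thesis using xy comp[of x y] by (simp add: K_def)
      qed
      have Y'': "card (Y - K) < card Y" "finite (Y - K)" "Y - K \<subseteq> X" "Y - K \<subseteq> Y'"
        using a(1) fin YX Y'(6) by (auto simp: K_def intro!: psubset_card_mono)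
      from less.hyps[OF Y''(1-3)] obtain A2 f2 where A2: "A2 \<subseteq> Y - K" "indep A2"
        and f2: "f2 ` (Y - K) \<subseteq> {..<card A2}"
        and comp2: "\<And>x y. x \<in> Y - K \<Longrightarrow> y \<in> Y - K \<Longrightarrow> f2 x = f2 y \<Longrightarrow> (x, y) \<in> r \<or> (y, x) \<in> r"
        unfolding indep_def by metis
      have A2Y: "A2 \<subseteq> Y'" using A2(1) Y''(4) by blast
      have "card A2 \<noteq> k"
      proof
        assume "card A2 = k"
        then obtain y where y: "y \<in> A2" "y \<in> M i" using M_meet A2Y A2(2) i(1) by blast
        then have "y \<in> K" using t(2)[OF i(1)] by (simp add: K_def M_def)
        then show False using y(1) A2(1) by blast
      qed
      then have lt: "card A2 < k" using small[OF A2Y A2(2)] by simp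
      define g where "g z = (if z \<in> K then k - 1 else f2 z)" for z
      have g_less: "g z < k - 1" if "z \<in> Y" "z \<notin> K" for z
        using that f2 lt by (force simp: g_def)
      have "g ` Y \<subseteq> {..<card A}"
      proof
        fix c assume "c \<in> g ` Y"
        then obtain z where "z \<in> Y" "c = g z" by blast
        then show "c \<in> {..<card A}"
          using g_less[of z] i(1) by (cases "z \<in> K") (auto simp: g_def k_def)
      qed
      moreover have "(x, y) \<in> r \<or> (y, x) \<in> r" if xy: "x \<in> Y" "y \<in> Y" "g x = g y" for x y
      proof -
        have "g z = k - 1 \<longleftrightarrow> z \<in> K" if "z \<in> Y" for z
          using g_less[of z] that by (auto simp: g_def)
        then have "x \<in> K \<longleftrightarrow> y \<in> K" using xy by metis
        then show ?thesis using K_chain comp2[of x y] xy by (auto simp: g_def)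
      qed
      moreover have "A \<subseteq> Y" using A(1) Y'(3) by blast
      ultimately show ?thesis
        using A(2) unfolding indep_def by (intro exI[of _ A] exI[of _ g]) simp
    qed
  qed
qed

text \<open>An antichain has at most one element in each chain. If an antichain has as many elements as
  there are chains, its size is the width, and it meets all chains.\<close>

lemma dilworth:
  assumes po: "partial_order_on X r" and fin: "finite X"
  shows "\<exists>f. f ` X = {..<poset_width X r} \<and>
    (\<forall>x\<in>X. \<forall>y\<in>X. f x = f y \<longrightarrow> (x, y) \<in> r \<or> (y, x) \<in> r)"
proof -
  obtain A f where A: "A \<subseteq> X" "\<forall>x\<in>A. \<forall>y\<in>A. (x, y) \<in> r \<longrightarrow> x = y"
    and f: "f ` X \<subseteq> {..<card A}"
    and comp: "\<forall>x\<in>X. \<forall>y\<in>X. f x = f y \<longrightarrow> (x, y) \<in> r \<or> (y, x) \<in> r"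
    using dilworth_colouring[OF po fin subset_refl] by auto
  have anti: "antichain X r A"
    using A by (auto simp: antichain_def incomparable_pairs_def)
  have inj: "inj_on f B" if "antichain X r B" for B
  proof (rule inj_onI, rule ccontr)
    fix x y assume xy: "x \<in> B" "y \<in> B" "f x = f y" "x \<noteq> y"
    then have "(x, y) \<in> incomparable_pairs X r" using that by (simp add: antichain_def)
    then show False using comp xy(3) by (auto simp: incomparable_pairs_def)
  qed
  have le: "card B \<le> card A" if "antichain X r B" for B
  proof -
    have "f ` B \<subseteq> {..<card A}" using f that by (auto simp: antichain_def)
    then show ?thesis using card_inj_on_le[OF inj[OF that], of "{..<card A}"] by simp
  qed
  have "finite {B. antichain X r B}"
    by (rule finite_subset[of _ "Pow X"]) (use fin in \<open>auto simp: antichain_def\<close>)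
  then have width: "poset_width X r = card A"
    unfolding poset_width_def using le anti by (intro Max_eqI) auto
  have "f ` A = {..<card A}"
    using f A(1) by (intro card_subset_eq) (auto simp: card_image[OF inj[OF anti]])
  then have "f ` X = {..<card A}" using f A(1) by blast
  then show ?thesis using comp width by metis
qed

section \<open>The extremal property of Turan posets\<close>

lemma partial_order_on_same_colour:
  assumes "partial_order_on X r"
  shows "partial_order_on X {(x, y) \<in> r. f x = f y}"
proof -
  have r: "r \<subseteq> X \<times> X" "refl_on X r" "trans r" "antisym r"
    using assms by (auto simp: partial_order_on_def preorder_on_def)
  show ?thesis
    unfolding partial_order_on_def preorder_on_def
  proof (intro conjI)
    show "{(x, y) \<in> r. f x = f y} \<subseteq> X \<times> X" using r(1) by auto
    show "refl_on X {(x, y) \<in> r. f x = f y}" using r(2) by (auto simp: refl_on_def)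
    show "trans {(x, y) \<in> r. f x = f y}"
      by (rule transI) (use transD[OF r(3)] in auto)
    show "antisym {(x, y) \<in> r. f x = f y}"
      by (rule antisymI) (use antisymD[OF r(4)] in auto)
  qed
qed

text \<open>The chains themselves serve as the colours of their elements.\<close>

lemma card_strict_alternating_cycles_turan_poset:
  fixes Y :: "'a set"
  assumes "turan_poset n w Y s"
  obtains \<C> :: "'a set set" where "finite \<C>" "card \<C> = w"
    "\<forall>C\<in>\<C>. card C = n div w \<or> card C = n div w + 1"
    "card {C \<in> \<C>. card C = n div w + 1} = n mod w"
    "card (strict_alternating_cycles Y s)
      = subset_product_sum cyclic_orders \<C> (\<lambda>C. triangular (card C))"
proof -
  have po: "partial_order_on Y s" and fin: "finite Y"
    using assms by (auto simp: turan_poset_def)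
  obtain \<C> where part: "partition_on Y \<C>" and card: "card \<C> = w"
    and chain: "\<forall>C\<in>\<C>. C \<in> Chains s"
    and cross: "\<forall>C\<in>\<C>. \<forall>D\<in>\<C>. C \<noteq> D \<longrightarrow> C \<times> D \<subseteq> incomparable_pairs Y s"
    and sizes: "\<forall>C\<in>\<C>. card C = n div w \<or> card C = n div w + 1"
      "card {C \<in> \<C>. card C = n div w + 1} = n mod w"
    using assms unfolding turan_poset_def by (elim exE conjE) (rule that; assumption)
  define f where "f y = (THE C. C \<in> \<C> \<and> y \<in> C)" for y
  have f_eq: "f y = C" if "C \<in> \<C>" "y \<in> C" for y C
    unfolding f_def
  proof (rule the_equality)
    show "D = C" if "D \<in> \<C> \<and> y \<in> D" for D
      using that \<open>C \<in> \<C>\<close> \<open>y \<in> C\<close> partition_onD2[OF part] by (auto dest: disjointD)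
  qed (use that in simp)
  have Y_Un: "Y = \<Union>\<C>" by (rule partition_onD1[OF part])
  have f_in: "f y \<in> \<C>" "y \<in> f y" if y: "y \<in> Y" for y
  proof -
    obtain C where "C \<in> \<C>" "y \<in> C" using y Y_Un by blast
    then show "f y \<in> \<C>" "y \<in> f y" using f_eq by simp_all
  qed
  have fibre: "{y \<in> Y. f y = C} = C" if "C \<in> \<C>" for C
  proof
    show "{y \<in> Y. f y = C} \<subseteq> C" using f_in(2) by blast
    show "C \<subseteq> {y \<in> Y. f y = C}" using that f_eq[OF that] Y_Un by blast
  qed
  have image: "f ` Y = \<C>"
  proof
    show "\<C> \<subseteq> f ` Y"
    proof
      fix C assume C: "C \<in> \<C>"
      then obtain y where "y \<in> C" using partition_onD3[OF part] by (metis ex_in_conv)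
      then show "C \<in> f ` Y" using C f_eq[OF C] Y_Un by (metis UnionI imageI)
    qed
  qed (use f_in in blast)
  have comp: "f x = f y \<longleftrightarrow> (x, y) \<in> s \<or> (y, x) \<in> s" if xy: "x \<in> Y" "y \<in> Y" for x y
  proof
    assume "f x = f y"
    then have "x \<in> f y" "y \<in> f y" "f y \<in> Chains s" using f_in xy chain by metis+
    then show "(x, y) \<in> s \<or> (y, x) \<in> s" by (auto simp: Chains_def)
  next
    assume le: "(x, y) \<in> s \<or> (y, x) \<in> s"
    show "f x = f y"
    proof (rule ccontr)
      assume "f x \<noteq> f y"
      then have "f x \<times> f y \<subseteq> incomparable_pairs Y s" using cross f_in xy by simp
      then have "(x, y) \<in> incomparable_pairs Y s" using f_in xy by blast
      then show False using le by (auto simp: incomparable_pairs_def)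
    qed
  qed
  show thesis
  proof (rule that[OF _ card sizes])
    show "finite \<C>" using fin image by auto
    have "card (strict_alternating_cycles Y s)
        = subset_product_sum cyclic_orders \<C> (\<lambda>C. triangular (card {y \<in> Y. f y = C}))"
      using card_strict_alternating_cycles_chain_union[OF po fin comp] image by simp
    also have "\<dots> = subset_product_sum cyclic_orders \<C> (\<lambda>C. triangular (card C))"
      by (intro subset_product_sum_cong) (simp add: fibre)
    finally show "card (strict_alternating_cycles Y s)
        = subset_product_sum cyclic_orders \<C> (\<lambda>C. triangular (card C))" .
  qed
qed

theorem corollary7p4:
  fixes X :: "'a set" and r :: "'a rel" and Y :: "'b set" and s :: "'b rel"
    and n w :: nat
  assumes "partial_order_on X r" and "finite X"
    and "card X = n" and "poset_width X r = w"
    and "turan_poset n w Y s"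
  shows "card (strict_alternating_cycles X r) \<le> card (strict_alternating_cycles Y s)"
proof -
  have w: "0 < w" using assms(5) by (simp add: turan_poset_def)
  obtain f where f: "f ` X = {..<w}"
    and comp: "\<And>x y. x \<in> X \<Longrightarrow> y \<in> X \<Longrightarrow> f x = f y \<Longrightarrow> (x, y) \<in> r \<or> (y, x) \<in> r"
    using dilworth[OF assms(1,2)] assms(4) by metis
  define q where "q = {(x, y) \<in> r. f x = f y}"
  define g where "g i = card {x \<in> X. f x = i}" for i
  have q_po: "partial_order_on X q"
    unfolding q_def by (rule partial_order_on_same_colour[OF assms(1)])
  have q_comp: "f x = f y \<longleftrightarrow> (x, y) \<in> q \<or> (y, x) \<in> q" if "x \<in> X" "y \<in> X" for x y
    using comp that by (auto simp: q_def)
  have total: "sum g {..<w} = n"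
    using sum.group[OF assms(2) finite_lessThan[of w] equalityD1[OF f], of "\<lambda>_. 1 :: nat"]
      assms(3) by (simp add: g_def)
  obtain \<C> :: "'b set set" where \<C>: "finite \<C>" "card \<C> = w"
    "\<forall>C\<in>\<C>. card C = n div w \<or> card C = n div w + 1"
    "card {C \<in> \<C>. card C = n div w + 1} = n mod w"
    and turan: "card (strict_alternating_cycles Y s)
      = subset_product_sum cyclic_orders \<C> (\<lambda>C. triangular (card C))"
    by (rule card_strict_alternating_cycles_turan_poset[OF assms(5)])
  have "\<C> \<noteq> {}" using \<C>(2) w by auto
  have "card (strict_alternating_cycles X r) \<le> card (strict_alternating_cycles X q)"
    unfolding q_def by (rule card_strict_alternating_cycles_le_refine[OF assms(1,2) comp])
  also have "\<dots> = subset_product_sum cyclic_orders {..<w} (\<lambda>i. triangular (g i))"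
    using card_strict_alternating_cycles_chain_union[OF q_po assms(2) q_comp]
    by (simp add: f g_def)
  also have "\<dots> \<le> subset_product_sum cyclic_orders \<C> (\<lambda>C. triangular (card C))"
    by (rule subset_product_sum_le_balanced[OF _ \<C>(1) _ \<open>\<C> \<noteq> {}\<close> total])
      (use \<C> in simp_all)
  finally show ?thesis unfolding turan .
qed

end
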